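(* Let $I=I_1\cup I_2\subset\mathbb{R}$ be an interval with $I_1,I_2$ subintervals, let $\Omega=(I_1\times I_1)\cup(I_2\times I_2)$, let $K_\Omega:\Omega\to\mathbb{R}$ be a partial covariance on $\Omega$ and let $K_\star$ be its canonical completion. A function $K:I\times I\to\mathbb{R}$ is a completion of $K_\Omega$ if and only if $$K=K_\star+C$$ for some $C:(I_1\cup I_2)^2\to\mathbb{R}$ satisfying $C(s,t)=0$ for $(s,t)\in I_1^2\cup I_2^2$ and such that the function $L:[(I_1\setminus I_2)\cup(I_2\setminus I_1)]^2\to\mathbb{R}$ given by $$L|_{(I_1\setminus I_2)^2}=K_{I_1}/K_{I_1\cap I_2},\qquad L|_{(I_1\setminus I_2)\times(I_2\setminus I_1)}=C|_{(I_1\setminus I_2)\times(I_2\setminus I_1)},$$ $$L|_{(I_2\setminus I_1)^2}=K_{I_2}/K_{I_1\cap I_2},\qquad L|_{(I_2\setminus I_1)\times(I_1\setminus I_2)}=C|_{(I_2\setminus I_1)\times(I_1\setminus I_2)}$$ is a covariance.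
   Context: A covariance on a set $S$ is a symmetric function $K:S\times S\to\mathbb{R}$ with $\sum_{i,j=1}^n\alpha_i\alpha_jK(t_i,t_j)\ge 0$ for all $n\ge1$, $t_i\in S$, $\alpha_i\in\mathbb{R}$. A partial covariance on $\Omega$ is a function $K_\Omega:\Omega\to\mathbb{R}$ such that for every $J\subset I$ (not necessarily an interval) with $J\times J\subset\Omega$, the restriction $K_J=K_\Omega|_{J\times J}$ is a covariance on $J$. A completion of $K_\Omega$ is a covariance $K$ on $I$ with $K|_\Omega=K_\Omega$. $\mathscr{H}(K_A)$ is the reproducing kernel Hilbert space of $K_A$ ($\mathscr{H}(K_\emptyset)=\{0\}$); functions inside its inner product are restricted to $A$. The canonical completion is $K_\star=K_\Omega$ on $\Omega$ and $K_\star(s,t)=\langle K_\Omega(s,\cdot),K_\Omega(\cdot,t)\rangle_{\mathscr{H}(K_{I_1\cap I_2})}$ for $(s,t)\notin\Omega$. For $A\subset B$, the Schur complement $K_B/K_A$ is the function $(K_B/K_A)(s,t)=K_B(s,t)-\langle K_B(s,\cdot),K_B(\cdot,t)\rangle_{\mathscr{H}(K_A)}$ on $(B\setminus A)^2$. *)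

theory Defs
  imports "HOL-Analysis.Analysis" "HOL-Library.FuncSet"
begin

text \<open>
  A kernel on a set \<open>S\<close> is a total function of type \<open>'a \<Rightarrow> 'a \<Rightarrow> real\<close>, of which only the values on
  \<open>S \<times> S\<close> matter; thus a restriction \<open>K|\<^bsub>A \<times> A\<^esub>\<close> is \<open>K\<close> together with the set \<open>A\<close>. Likewise a kernel
  on \<open>\<Omega>\<close> is a total function of which only the values on \<open>\<Omega>\<close> matter.
\<close>

definition covariance_on :: "'a set \<Rightarrow> ('a \<Rightarrow> 'a \<Rightarrow> real) \<Rightarrow> bool" where
  "covariance_on S K \<longleftrightarrow>
     (\<forall>s\<in>S. \<forall>t\<in>S. K s t = K t s) \<and>
     (\<forall>n\<ge>1. \<forall>(t :: nat \<Rightarrow> 'a) (\<alpha> :: nat \<Rightarrow> real). (\<forall>i\<in>{1..n}. t i \<in> S) \<longrightarrow>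
        (\<Sum>i=1..n. \<Sum>j=1..n. \<alpha> i * \<alpha> j * K (t i) (t j)) \<ge> 0)"

definition partial_covariance_on :: "'a set \<Rightarrow> ('a \<times> 'a) set \<Rightarrow> ('a \<Rightarrow> 'a \<Rightarrow> real) \<Rightarrow> bool" where
  "partial_covariance_on I \<Omega> K \<longleftrightarrow> (\<forall>J \<subseteq> I. J \<times> J \<subseteq> \<Omega> \<longrightarrow> covariance_on J K)"

definition is_completion ::
  "'a set \<Rightarrow> ('a \<times> 'a) set \<Rightarrow> ('a \<Rightarrow> 'a \<Rightarrow> real) \<Rightarrow> ('a \<Rightarrow> 'a \<Rightarrow> real) \<Rightarrow> bool" where
  "is_completion I \<Omega> K\<^sub>\<Omega> K \<longleftrightarrow> covariance_on I K \<and> (\<forall>(s, t)\<in>\<Omega>. K s t = K\<^sub>\<Omega> s t)"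

text \<open>
  Real Hilbert spaces of functions on \<open>S\<close>, with pointwise operations. Functions on \<open>S\<close> are
  represented by the extensional functions, so that equality on \<open>S\<close> is equality.
\<close>

locale function_hilbert_space =
  fixes S :: "'a set"
    and H :: "('a \<Rightarrow> real) set"
    and ip :: "('a \<Rightarrow> real) \<Rightarrow> ('a \<Rightarrow> real) \<Rightarrow> real"
  assumes extensional: "H \<subseteq> extensional S"
    and zero_mem: "(\<lambda>x\<in>S. 0) \<in> H"
    and add_mem: "\<And>f g. f \<in> H \<Longrightarrow> g \<in> H \<Longrightarrow> (\<lambda>x\<in>S. f x + g x) \<in> H"
    and scale_mem: "\<And>c f. f \<in> H \<Longrightarrow> (\<lambda>x\<in>S. c * f x) \<in> H"
    and ip_commute: "\<And>f g. f \<in> H \<Longrightarrow> g \<in> H \<Longrightarrow> ip f g = ip g f"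
    and ip_add_left:
      "\<And>f g h. f \<in> H \<Longrightarrow> g \<in> H \<Longrightarrow> h \<in> H \<Longrightarrow> ip (\<lambda>x\<in>S. f x + g x) h = ip f h + ip g h"
    and ip_scale_left:
      "\<And>c f g. f \<in> H \<Longrightarrow> g \<in> H \<Longrightarrow> ip (\<lambda>x\<in>S. c * f x) g = c * ip f g"
    and ip_nonneg: "\<And>f. f \<in> H \<Longrightarrow> ip f f \<ge> 0"
    and ip_definite: "\<And>f. f \<in> H \<Longrightarrow> ip f f = 0 \<Longrightarrow> f = (\<lambda>x\<in>S. 0)"
    and complete:
      "\<And>F :: nat \<Rightarrow> 'a \<Rightarrow> real. \<forall>n. F n \<in> H \<Longrightarrow>
         \<forall>e>0. \<exists>N. \<forall>m\<ge>N. \<forall>n\<ge>N.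
           sqrt (ip (\<lambda>x\<in>S. F m x - F n x) (\<lambda>x\<in>S. F m x - F n x)) < e \<Longrightarrow>
         \<exists>f\<in>H. (\<lambda>n. sqrt (ip (\<lambda>x\<in>S. F n x - f x) (\<lambda>x\<in>S. F n x - f x))) \<longlonglongrightarrow> 0"

locale reproducing_kernel_hilbert_space = function_hilbert_space S H ip
  for S :: "'a set"
    and K :: "'a \<Rightarrow> 'a \<Rightarrow> real"
    and H :: "('a \<Rightarrow> real) set"
    and ip :: "('a \<Rightarrow> real) \<Rightarrow> ('a \<Rightarrow> real) \<Rightarrow> real" +
  assumes kernel_mem: "\<And>t. t \<in> S \<Longrightarrow> (\<lambda>x\<in>S. K t x) \<in> H"
    and reproducing: "\<And>f t. f \<in> H \<Longrightarrow> t \<in> S \<Longrightarrow> ip f (\<lambda>x\<in>S. K t x) = f t"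

text \<open>
  By the Moore--Aronszajn theorem a covariance \<open>K\<close> on \<open>S\<close> has a reproducing kernel Hilbert space,
  and both its carrier and its inner product on the carrier are unique. The choice below is only
  between extensions of the inner product to pairs of functions outside the carrier. For \<open>S = {}\<close> the
  carrier consists of the zero function alone.
\<close>

definition rkhs ::
  "'a set \<Rightarrow> ('a \<Rightarrow> 'a \<Rightarrow> real) \<Rightarrow>
     ('a \<Rightarrow> real) set \<times> (('a \<Rightarrow> real) \<Rightarrow> ('a \<Rightarrow> real) \<Rightarrow> real)" where
  "rkhs S K = (SOME (H, ip). reproducing_kernel_hilbert_space S K H ip)"

definition rkhs_inner ::
  "'a set \<Rightarrow> ('a \<Rightarrow> 'a \<Rightarrow> real) \<Rightarrow> ('a \<Rightarrow> real) \<Rightarrow> ('a \<Rightarrow> real) \<Rightarrow> real" where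
  "rkhs_inner S K f g = snd (rkhs S K) (restrict f S) (restrict g S)"

definition two_block_domain :: "'a set \<Rightarrow> 'a set \<Rightarrow> ('a \<times> 'a) set" where
  "two_block_domain I\<^sub>1 I\<^sub>2 = (I\<^sub>1 \<times> I\<^sub>1) \<union> (I\<^sub>2 \<times> I\<^sub>2)"

definition canonical_completion ::
  "'a set \<Rightarrow> 'a set \<Rightarrow> ('a \<Rightarrow> 'a \<Rightarrow> real) \<Rightarrow> 'a \<Rightarrow> 'a \<Rightarrow> real" where
  "canonical_completion I\<^sub>1 I\<^sub>2 K\<^sub>\<Omega> s t =
     (if (s, t) \<in> two_block_domain I\<^sub>1 I\<^sub>2 then K\<^sub>\<Omega> s t
      else rkhs_inner (I\<^sub>1 \<inter> I\<^sub>2) K\<^sub>\<Omega> (\<lambda>x. K\<^sub>\<Omega> s x) (\<lambda>x. K\<^sub>\<Omega> x t))"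

text \<open>
  \<open>schur_complement K A\<close> is \<open>K\<^sub>B / K\<^sub>A\<close>, where \<open>K\<^sub>B\<close> and \<open>K\<^sub>A\<close> are the restrictions of \<open>K\<close>; it is
  meaningful at arguments in \<open>B - A\<close>, and its values there do not depend on the set \<open>B \<supseteq> A\<close>.
\<close>

definition schur_complement :: "('a \<Rightarrow> 'a \<Rightarrow> real) \<Rightarrow> 'a set \<Rightarrow> 'a \<Rightarrow> 'a \<Rightarrow> real" where
  "schur_complement K A s t = K s t - rkhs_inner A K (\<lambda>x. K s x) (\<lambda>x. K x t)"

end

theory Submission
  imports Defs
begin

text \<open>
  Put \<open>A = I\<^sub>1 \<inter> I\<^sub>2\<close> and let \<open>k\<^sub>s\<close> be the restriction of \<open>K\<^sub>\<Omega>(s, \<cdot>)\<close> to \<open>A\<close>. Every \<open>k\<^sub>s\<close> with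
  \<open>s \<in> I\<close> belongs to the reproducing kernel Hilbert space \<open>\<H>\<close> of \<open>K\<^sub>A\<close>, and \<open>P(s, t) = \<langle>k\<^sub>s, k\<^sub>t\<rangle>\<close> agrees
  with \<open>K\<^sub>\<Omega>(s, t)\<close> as soon as \<open>s\<close> or \<open>t\<close> lies in \<open>A\<close>, by the reproducing property. Hence, whenever
  \<open>K = K\<^sub>\<star> + C\<close> with \<open>C = 0\<close> on \<open>\<Omega>\<close>, the difference \<open>K - P\<close> vanishes on all pairs that meet \<open>A\<close>, and on
  the remaining pairs, those of points of \<open>I - A\<close>, it is exactly the kernel \<open>L\<close> of the theorem: a
  Schur complement inside a block, \<open>C\<close> across the blocks. The theorem then says that \<open>K\<close> is a
  covariance iff \<open>K - P\<close> is.

  If \<open>K - P\<close> is a covariance on \<open>I - A\<close>, so is its extension by zero to \<open>I\<close>; since \<open>P\<close> is a covariance,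
  being the Gram kernel of the vectors \<open>k\<^sub>s\<close>, so is the sum \<open>K\<close>. Conversely, if \<open>K\<close> is a covariance on
  \<open>I\<close>, then restriction of functions from \<open>I\<close> to \<open>A\<close> is a contraction from the span of the sections
  \<open>K(s, \<cdot>)\<close>, normed by the quadratic form of \<open>K\<close>, into \<open>\<H>\<close>
  (\<open>restriction_contraction\<close>). For \<open>\<Sum>\<^sub>s u\<^sub>s K(s, \<cdot>)\<close> the contraction inequality reads
  \<open>\<Sum> u\<^sub>s u\<^sub>t P(s, t) \<le> \<Sum> u\<^sub>s u\<^sub>t K(s, t)\<close>, which is the positivity of \<open>K - P\<close>
  (\<open>covariance_on_schur_complement\<close>).

  All this presupposes that \<open>\<H>\<close> exists, which is the Moore--Aronszajn theorem (\<open>moore_aronszajn\<close>).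
\<close>

section \<open>Finitely supported coefficients and the Gram form\<close>

text \<open>
  Finite linear combinations of kernel sections are handled through their coefficients, functions of
  finite support. Equality of two combinations as functions on \<open>S\<close> does not determine the coefficients,
  but working with the coefficients avoids having to show that the inner product of two combinations
  is well defined.
\<close>

definition finsupp :: "'a set \<Rightarrow> ('a \<Rightarrow> real) set" where
  "finsupp S = {u. finite {x. u x \<noteq> 0} \<and> {x. u x \<noteq> 0} \<subseteq> S}"

definition pairing :: "('a \<Rightarrow> real) \<Rightarrow> ('a \<Rightarrow> real) \<Rightarrow> real" where
  "pairing u f = (\<Sum>x | u x \<noteq> 0. u x * f x)"

text \<open>
  This is the bilinear form \<open>\<Sum>\<^sub>x\<^sub>,\<^sub>y u\<^sub>x v\<^sub>y K(x, y)\<close>. The nested form shows its meaning: a functional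
  \<open>u\<close> of finite support is applied to the function \<open>x \<mapsto> \<Sum>\<^sub>y v\<^sub>y K(x, y)\<close> that \<open>v\<close> represents.
\<close>

definition gram :: "('a \<Rightarrow> 'a \<Rightarrow> real) \<Rightarrow> ('a \<Rightarrow> real) \<Rightarrow> ('a \<Rightarrow> real) \<Rightarrow> real" where
  "gram K u v = pairing u (\<lambda>x. pairing v (K x))"

definition point_mass :: "'a \<Rightarrow> 'a \<Rightarrow> real" where
  "point_mass t = (\<lambda>x. if x = t then 1 else 0)"

lemma finsupp_mono: "A \<subseteq> B \<Longrightarrow> u \<in> finsupp A \<Longrightarrow> u \<in> finsupp B"
  by (auto simp: finsupp_def)

lemma finsupp_lincomb:
  assumes "u \<in> finsupp S" "v \<in> finsupp S"
  shows "(\<lambda>x. a * u x + b * v x) \<in> finsupp S"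
proof -
  have "{x. a * u x + b * v x \<noteq> 0} \<subseteq> {x. u x \<noteq> 0} \<union> {x. v x \<noteq> 0}" by auto
  then show ?thesis
    using assms by (auto simp: finsupp_def intro: finite_subset)
qed

lemma finsupp_zero [simp]: "(\<lambda>x. 0) \<in> finsupp S"
  by (simp add: finsupp_def)

lemma finsupp_add [simp]:
    "u \<in> finsupp S \<Longrightarrow> v \<in> finsupp S \<Longrightarrow> (\<lambda>x. u x + v x) \<in> finsupp S"
  and finsupp_diff [simp]:
    "u \<in> finsupp S \<Longrightarrow> v \<in> finsupp S \<Longrightarrow> (\<lambda>x. u x - v x) \<in> finsupp S"
  and finsupp_scale [simp]: "u \<in> finsupp S \<Longrightarrow> (\<lambda>x. c * u x) \<in> finsupp S"
  using finsupp_lincomb[of u S v 1 1] finsupp_lincomb[of u S v 1 "-1"]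
    finsupp_lincomb[of u S u c 0] by simp_all

lemma finsupp_point_mass [simp]: "t \<in> S \<Longrightarrow> point_mass t \<in> finsupp S"
  by (auto simp: finsupp_def point_mass_def)

lemma pairing_superset:
  assumes "finite F" "{x. u x \<noteq> 0} \<subseteq> F"
  shows "pairing u f = (\<Sum>x\<in>F. u x * f x)"
  unfolding pairing_def using assms by (intro sum.mono_neutral_left) auto

lemma pairing_lincomb_left:
  assumes "u \<in> finsupp S" "v \<in> finsupp S"
  shows "pairing (\<lambda>x. a * u x + b * v x) f = a * pairing u f + b * pairing v f"
proof -
  let ?F = "{x. u x \<noteq> 0} \<union> {x. v x \<noteq> 0}"
  have F: "finite ?F" using assms by (auto simp: finsupp_def)
  have "pairing (\<lambda>x. a * u x + b * v x) f = (\<Sum>x\<in>?F. (a * u x + b * v x) * f x)"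
    by (intro pairing_superset F) auto
  also have "\<dots> = a * (\<Sum>x\<in>?F. u x * f x) + b * (\<Sum>x\<in>?F. v x * f x)"
    by (simp add: sum_distrib_left sum.distrib algebra_simps)
  also have "(\<Sum>x\<in>?F. u x * f x) = pairing u f"
    using F by (intro pairing_superset[symmetric]) auto
  also have "(\<Sum>x\<in>?F. v x * f x) = pairing v f"
    using F by (intro pairing_superset[symmetric]) auto
  finally show ?thesis .
qed

lemma pairing_lincomb_right:
  "pairing u (\<lambda>x. a * f x + b * g x) = a * pairing u f + b * pairing u g"
  by (simp add: pairing_def sum_distrib_left sum.distrib algebra_simps)

lemma pairing_cong:
  assumes "u \<in> finsupp S" "\<And>x. x \<in> S \<Longrightarrow> f x = g x"
  shows "pairing u f = pairing u g"
  unfolding pairing_def using assms by (intro sum.cong) (auto simp: finsupp_def)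

lemma pairing_point_mass [simp]: "pairing (point_mass t) f = f t"
  by (simp add: pairing_def point_mass_def)

lemma gram_lincomb_left:
  assumes "u \<in> finsupp S" "v \<in> finsupp S"
  shows "gram K (\<lambda>x. a * u x + b * v x) w = a * gram K u w + b * gram K v w"
  unfolding gram_def by (rule pairing_lincomb_left[OF assms])

lemma gram_lincomb_right:
  assumes "u \<in> finsupp S" "v \<in> finsupp S"
  shows "gram K w (\<lambda>x. a * u x + b * v x) = a * gram K w u + b * gram K w v"
  unfolding gram_def pairing_lincomb_left[OF assms] by (rule pairing_lincomb_right)

lemma gram_eq_sum: "gram K u v = (\<Sum>x | u x \<noteq> 0. \<Sum>y | v y \<noteq> 0. u x * v y * K x y)"
  by (simp add: gram_def pairing_def sum_distrib_left mult_ac)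

lemma gram_commute:
  assumes "\<And>x y. x \<in> S \<Longrightarrow> y \<in> S \<Longrightarrow> K x y = K y x" "u \<in> finsupp S" "v \<in> finsupp S"
  shows "gram K u v = gram K v u"
proof -
  have "gram K u v = (\<Sum>y | v y \<noteq> 0. \<Sum>x | u x \<noteq> 0. u x * v y * K x y)"
    unfolding gram_eq_sum by (rule sum.swap)
  also have "\<dots> = gram K v u"
    unfolding gram_eq_sum using assms by (intro sum.cong) (auto simp: finsupp_def)
  finally show ?thesis .
qed

text \<open>
  The points \<open>t\<^sub>1, \<dots>, t\<^sub>n\<close> in the definition of a covariance may repeat. Adding up the coefficients
  that belong to the same point turns such a family into a single finitely supported function with the
  same quadratic form; conversely, an enumeration of the support is such a family.
\<close>

lemma covariance_on_iff_gram:
  "covariance_on S K \<longleftrightarrow>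
     (\<forall>s\<in>S. \<forall>t\<in>S. K s t = K t s) \<and> (\<forall>u\<in>finsupp S. gram K u u \<ge> 0)"
proof -
  have gram_ge: "gram K u u \<ge> 0"
    if cov: "covariance_on S K" and u: "u \<in> finsupp S" for u
  proof (cases "{x. u x \<noteq> 0} = {}")
    case False
    define n where "n = card {x. u x \<noteq> 0}"
    have fin: "finite {x. u x \<noteq> 0}" and sub: "{x. u x \<noteq> 0} \<subseteq> S"
      using u by (auto simp: finsupp_def)
    obtain t where t: "bij_betw t {1..n} {x. u x \<noteq> 0}"
      using ex_bij_betw_nat_finite_1[OF fin] n_def by blast
    have "n \<ge> 1" using False fin by (simp add: n_def card_gt_0_iff Suc_le_eq)
    moreover have "\<forall>i\<in>{1..n}. t i \<in> S" using t sub by (auto simp: bij_betw_def)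
    ultimately have "0 \<le> (\<Sum>i=1..n. \<Sum>j=1..n. u (t i) * u (t j) * K (t i) (t j))"
      using cov[unfolded covariance_on_def, THEN conjunct2, rule_format, of n t "\<lambda>i. u (t i)"]
      by blast
    also have "\<dots> = (\<Sum>i=1..n. \<Sum>y | u y \<noteq> 0. u (t i) * u y * K (t i) y)"
      by (intro sum.cong refl sum.reindex_bij_betw[OF t])
    also have "\<dots> = gram K u u"
      unfolding gram_eq_sum by (rule sum.reindex_bij_betw[OF t])
    finally show ?thesis .
  qed (simp add: gram_eq_sum)
  have sum_ge: "0 \<le> (\<Sum>i=1..n. \<Sum>j=1..n. \<alpha> i * \<alpha> j * K (t i) (t j))"
    if pd: "\<forall>u\<in>finsupp S. gram K u u \<ge> 0" and t: "\<forall>i\<in>{1..n}. t i \<in> S"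
    for n :: nat and t :: "nat \<Rightarrow> 'a" and \<alpha> :: "nat \<Rightarrow> real"
  proof -
    let ?u = "\<lambda>x. \<Sum>i | i \<in> {1..n} \<and> t i = x. \<alpha> i"
    have supp: "{x. ?u x \<noteq> 0} \<subseteq> t ` {1..n}"
    proof
      fix x assume nonzero: "x \<in> {x. ?u x \<noteq> 0}"
      show "x \<in> t ` {1..n}"
      proof (rule ccontr)
        assume "x \<notin> t ` {1..n}"
        then have "{i. i \<in> {1..n} \<and> t i = x} = {}" by blast
        then have "?u x = 0" by (simp only: sum.empty)
        with nonzero show False by simp
      qed
    qed
    have pair: "pairing ?u f = (\<Sum>i=1..n. \<alpha> i * f (t i))" for f
    proof -
      have "pairing ?u f = (\<Sum>x\<in>t ` {1..n}. ?u x * f x)"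
        by (rule pairing_superset) (use supp in auto)
      also have "\<dots> = (\<Sum>x\<in>t ` {1..n}. \<Sum>i | i \<in> {1..n} \<and> t i = x. \<alpha> i * f (t i))"
        by (simp add: sum_distrib_right)
      also have "\<dots> = (\<Sum>i=1..n. \<alpha> i * f (t i))"
        by (rule sum.image_gen[symmetric]) simp
      finally show ?thesis .
    qed
    have "?u \<in> finsupp S"
      using supp t unfolding finsupp_def by (auto intro: finite_subset)
    with pd have "0 \<le> gram K ?u ?u" by blast
    also have "\<dots> = (\<Sum>i=1..n. \<Sum>j=1..n. \<alpha> i * \<alpha> j * K (t i) (t j))"
      unfolding gram_def pair by (simp add: sum_distrib_left mult_ac)
    finally show ?thesis .
  qed
  show ?thesis
    using gram_ge sum_ge unfolding covariance_on_def by blast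
qed

text \<open>
  The common core of the Cauchy--Schwarz inequalities below and of the orthogonality relation for
  minimising sequences.
\<close>

lemma nonneg_quadratic_imp_discriminant:
  fixes a b d :: real
  assumes nonneg: "\<And>c. 0 \<le> a + 2 * c * b + c\<^sup>2 * d" and "d \<ge> 0"
  shows "b\<^sup>2 \<le> a * d"
proof (cases "d = 0")
  case True
  have "b = 0"
  proof (rule ccontr)
    assume "b \<noteq> 0"
    then show False using nonneg[of "- (a + 1) / (2 * b)"] True by (simp add: field_simps)
  qed
  then show ?thesis using True by simp
next
  case False
  with \<open>d \<ge> 0\<close> have d: "d > 0" by simp
  have "0 \<le> a + 2 * (- b / d) * b + (- b / d)\<^sup>2 * d" by (rule nonneg)
  also have "\<dots> = a - b\<^sup>2 / d" using d by (simp add: field_simps power2_eq_square)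
  finally show ?thesis using d by (simp add: field_simps)
qed

section \<open>The Moore--Aronszajn theorem\<close>

text \<open>
  The Hilbert space is the completion of the coefficient space under the semi-norm of the Gram form,
  realised by functions: a Cauchy sequence of coefficients is identified with the pointwise limit of
  the combinations of kernel sections that it represents.
\<close>

locale covariance_kernel =
  fixes S :: "'a set" and K :: "'a \<Rightarrow> 'a \<Rightarrow> real"
  assumes covariance: "covariance_on S K"
begin

abbreviation V :: "('a \<Rightarrow> real) set" where "V \<equiv> finsupp S"

definition nrm :: "('a \<Rightarrow> real) \<Rightarrow> real" where
  "nrm u = sqrt (gram K u u)"

lemma kernel_commute: "s \<in> S \<Longrightarrow> t \<in> S \<Longrightarrow> K s t = K t s"
  using covariance by (auto simp: covariance_on_def)

lemma gram_nonneg: "u \<in> V \<Longrightarrow> gram K u u \<ge> 0"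
  using covariance by (simp add: covariance_on_iff_gram)

lemma gram_sym: "u \<in> V \<Longrightarrow> v \<in> V \<Longrightarrow> gram K u v = gram K v u"
  by (rule gram_commute[OF kernel_commute])

lemma gram_add_diff:
  assumes "u \<in> V" "v \<in> V"
  shows "gram K (\<lambda>x. u x + v x) w = gram K u w + gram K v w"
    and "gram K (\<lambda>x. u x - v x) w = gram K u w - gram K v w"
    and "gram K w (\<lambda>x. u x + v x) = gram K w u + gram K w v"
    and "gram K w (\<lambda>x. u x - v x) = gram K w u - gram K w v"
  using gram_lincomb_left[OF assms, of K 1 1 w] gram_lincomb_left[OF assms, of K 1 "-1" w]
    gram_lincomb_right[OF assms, of K w 1 1] gram_lincomb_right[OF assms, of K w 1 "-1"]
  by simp_all

lemma gram_scale:
  assumes "u \<in> V"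
  shows "gram K (\<lambda>x. c * u x) w = c * gram K u w"
    and "gram K w (\<lambda>x. c * u x) = c * gram K w u"
  using gram_lincomb_left[OF assms assms, of K c 0 w] gram_lincomb_right[OF assms assms, of K w c 0]
  by simp_all

lemmas gram_linear = gram_add_diff gram_scale

lemma gram_add_scale:
  assumes "u \<in> V" "v \<in> V"
  shows "gram K (\<lambda>x. u x + c * v x) (\<lambda>x. u x + c * v x)
    = gram K u u + 2 * c * gram K u v + c\<^sup>2 * gram K v v"
  using assms by (simp add: gram_linear gram_sym[of v u] power2_eq_square algebra_simps)

lemma nrm_nonneg [simp]: "u \<in> V \<Longrightarrow> nrm u \<ge> 0"
  by (simp add: nrm_def gram_nonneg)

lemma nrm_power2: "u \<in> V \<Longrightarrow> (nrm u)\<^sup>2 = gram K u u"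
  by (simp add: nrm_def gram_nonneg)

lemma abs_gram_le:
  assumes "u \<in> V" "v \<in> V"
  shows "\<bar>gram K u v\<bar> \<le> nrm u * nrm v"
proof -
  have "(gram K u v)\<^sup>2 \<le> gram K u u * gram K v v"
  proof (rule nonneg_quadratic_imp_discriminant)
    fix c
    have "0 \<le> gram K (\<lambda>x. u x + c * v x) (\<lambda>x. u x + c * v x)"
      using assms by (intro gram_nonneg) simp
    also have "\<dots> = gram K u u + 2 * c * gram K u v + c\<^sup>2 * gram K v v"
      using assms by (rule gram_add_scale)
    finally show "0 \<le> gram K u u + 2 * c * gram K u v + c\<^sup>2 * gram K v v" .
  qed (use assms gram_nonneg in auto)
  then have "(gram K u v)\<^sup>2 \<le> (nrm u * nrm v)\<^sup>2"
    using assms by (simp add: power_mult_distrib nrm_power2)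
  then show ?thesis
    using assms by (auto intro: power2_le_imp_le[of "\<bar>gram K u v\<bar>"])
qed

lemma nrm_add_le:
  assumes "u \<in> V" "v \<in> V"
  shows "nrm (\<lambda>x. u x + v x) \<le> nrm u + nrm v"
proof (rule power2_le_imp_le)
  have "(nrm (\<lambda>x. u x + v x))\<^sup>2 = gram K u u + 2 * gram K u v + gram K v v"
    using assms by (simp add: nrm_power2 gram_linear gram_sym[of v u])
  also have "\<dots> \<le> (nrm u)\<^sup>2 + 2 * (nrm u * nrm v) + (nrm v)\<^sup>2"
    using assms abs_gram_le[OF assms] by (simp add: nrm_power2)
  finally show "(nrm (\<lambda>x. u x + v x))\<^sup>2 \<le> (nrm u + nrm v)\<^sup>2"
    by (simp add: power2_eq_square algebra_simps)
qed (use assms in auto)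

lemma nrm_scale: "u \<in> V \<Longrightarrow> nrm (\<lambda>x. c * u x) = \<bar>c\<bar> * nrm u"
  by (simp add: nrm_def gram_linear real_sqrt_mult)

lemma nrm_diff_commute: "u \<in> V \<Longrightarrow> v \<in> V \<Longrightarrow> nrm (\<lambda>x. u x - v x) = nrm (\<lambda>x. v x - u x)"
  by (simp add: nrm_def gram_linear)

lemma nrm_triangle:
  assumes "u \<in> V" "v \<in> V" "w \<in> V"
  shows "nrm (\<lambda>x. u x - w x) \<le> nrm (\<lambda>x. u x - v x) + nrm (\<lambda>x. v x - w x)"
  using nrm_add_le[of "\<lambda>x. u x - v x" "\<lambda>x. v x - w x"] assms by simp

definition cauchy_coeffs :: "(nat \<Rightarrow> 'a \<Rightarrow> real) \<Rightarrow> bool" where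
  "cauchy_coeffs U \<longleftrightarrow> (\<forall>n. U n \<in> V) \<and>
     (\<forall>e>0. \<exists>N. \<forall>m\<ge>N. \<forall>n\<ge>N. nrm (\<lambda>x. U m x - U n x) < e)"

definition represents :: "(nat \<Rightarrow> 'a \<Rightarrow> real) \<Rightarrow> ('a \<Rightarrow> real) \<Rightarrow> bool" where
  "represents U f \<longleftrightarrow> cauchy_coeffs U \<and> f \<in> extensional S \<and>
     (\<forall>t\<in>S. (\<lambda>n. pairing (U n) (K t)) \<longlonglongrightarrow> f t)"

lemma cauchy_coeffs_mem: "cauchy_coeffs U \<Longrightarrow> U n \<in> V"
  by (simp add: cauchy_coeffs_def)

lemma represents_cauchy: "represents U f \<Longrightarrow> cauchy_coeffs U"
  by (simp add: represents_def)

lemma represents_mem: "represents U f \<Longrightarrow> U n \<in> V"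
  by (simp add: represents_def cauchy_coeffs_mem)

lemma cauchy_coeffsE:
  assumes "cauchy_coeffs U" "e > 0"
  obtains N where "\<And>m n. m \<ge> N \<Longrightarrow> n \<ge> N \<Longrightarrow> nrm (\<lambda>x. U m x - U n x) < e"
  using assms unfolding cauchy_coeffs_def by blast

lemma cauchy_coeffs_bounded:
  assumes "cauchy_coeffs U"
  obtains M N where "M > 0" "\<And>n. n \<ge> N \<Longrightarrow> nrm (U n) \<le> M"
proof -
  obtain N where N: "\<And>m n. m \<ge> N \<Longrightarrow> n \<ge> N \<Longrightarrow> nrm (\<lambda>x. U m x - U n x) < 1"
    using cauchy_coeffsE[OF assms zero_less_one] by blast
  have "nrm (U n) \<le> nrm (U N) + 1" if "n \<ge> N" for n
    using nrm_add_le[of "\<lambda>x. U n x - U N x" "U N"] N[of n N] that assms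
    by (simp add: cauchy_coeffs_mem)
  moreover have "nrm (U N) + 1 > 0"
    using assms nrm_nonneg[of "U N"] by (simp add: cauchy_coeffs_mem del: nrm_nonneg)
  ultimately show ?thesis using that by blast
qed

lemma pairing_tendsto:
  assumes "represents U f" "v \<in> V"
  shows "(\<lambda>n. gram K v (U n)) \<longlonglongrightarrow> pairing v f"
  unfolding gram_def pairing_def[of v]
  using assms by (intro tendsto_sum tendsto_mult_left) (auto simp: represents_def finsupp_def)

text \<open>
  This makes the inner product well defined. By \<open>pairing_tendsto\<close>, \<open>\<langle>W\<^sub>n, f\<rangle>\<close> is the limit of
  \<open>\<langle>W\<^sub>n, U\<^sub>m\<rangle>\<close> as \<open>m\<close> grows, so that its distance to \<open>\<langle>U\<^sub>n, W\<^sub>n\<rangle>\<close> is at most the supremum of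
  \<open>\<parallel>U\<^sub>n - U\<^sub>m\<parallel> \<parallel>W\<^sub>n\<parallel>\<close> over large \<open>m\<close>. Thus the limit of \<open>\<langle>U\<^sub>n, W\<^sub>n\<rangle>\<close> depends on \<open>U\<close> only through
  the function \<open>f\<close>.
\<close>

lemma gram_minus_pairing_tendsto:
  assumes U: "represents U f" and W: "cauchy_coeffs W"
  shows "(\<lambda>n. gram K (U n) (W n) - pairing (W n) f) \<longlonglongrightarrow> 0"
proof (rule LIMSEQ_I)
  fix e :: real assume "e > 0"
  obtain M N where M: "M > 0" and bnd: "\<And>n. n \<ge> N \<Longrightarrow> nrm (W n) \<le> M"
    using cauchy_coeffs_bounded[OF W] by blast
  obtain N' where N': "\<And>m n. m \<ge> N' \<Longrightarrow> n \<ge> N' \<Longrightarrow> nrm (\<lambda>x. U m x - U n x) < e / (2 * M)"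
    using \<open>e > 0\<close> M by (rule_tac cauchy_coeffsE[OF represents_cauchy[OF U], of "e / (2 * M)"]) auto
  note mem [simp] = represents_mem[OF U] cauchy_coeffs_mem[OF W]
  have "\<bar>gram K (U n) (W n) - pairing (W n) f\<bar> \<le> e / 2" if n: "n \<ge> max N N'" for n
  proof (rule LIMSEQ_le_const2)
    show "(\<lambda>m. \<bar>gram K (U n) (W n) - gram K (W n) (U m)\<bar>)
            \<longlonglongrightarrow> \<bar>gram K (U n) (W n) - pairing (W n) f\<bar>"
      by (intro tendsto_intros pairing_tendsto U) simp
    have "\<bar>gram K (U n) (W n) - gram K (W n) (U m)\<bar> \<le> e / 2" if m: "m \<ge> N'" for m
    proof -
      have "\<bar>gram K (U n) (W n) - gram K (W n) (U m)\<bar> = \<bar>gram K (W n) (\<lambda>x. U n x - U m x)\<bar>"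
        by (simp add: gram_linear gram_sym[of "U n"])
      also have "\<dots> \<le> nrm (W n) * nrm (\<lambda>x. U n x - U m x)"
        by (rule abs_gram_le) simp_all
      also have "\<dots> \<le> M * (e / (2 * M))"
        using n m bnd[of n] N'[of n m] M by (intro mult_mono) auto
      finally show ?thesis using M by simp
    qed
    then show "\<exists>N. \<forall>m\<ge>N. \<bar>gram K (U n) (W n) - gram K (W n) (U m)\<bar> \<le> e / 2" by blast
  qed
  then show "\<exists>no. \<forall>n\<ge>no. norm (gram K (U n) (W n) - pairing (W n) f - 0) < e"
    using \<open>e > 0\<close> by (intro exI[of _ "max N N'"]) fastforce
qed

lemma gram_convergent:
  assumes U: "cauchy_coeffs U" and W: "cauchy_coeffs W"
  shows "convergent (\<lambda>n. gram K (U n) (W n))"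
proof (rule Cauchy_convergent, rule metric_CauchyI)
  fix e :: real assume "e > 0"
  obtain M N where M: "M > 0" and bnd: "\<And>n. n \<ge> N \<Longrightarrow> nrm (W n) \<le> M"
    using cauchy_coeffs_bounded[OF W] by blast
  obtain M' L where M': "M' > 0" and bnd': "\<And>n. n \<ge> L \<Longrightarrow> nrm (U n) \<le> M'"
    using cauchy_coeffs_bounded[OF U] by blast
  obtain N' where N': "\<And>m n. m \<ge> N' \<Longrightarrow> n \<ge> N' \<Longrightarrow> nrm (\<lambda>x. U m x - U n x) < e / (2 * M)"
    using \<open>e > 0\<close> M by (rule_tac cauchy_coeffsE[OF U, of "e / (2 * M)"]) auto
  obtain L' where L': "\<And>m n. m \<ge> L' \<Longrightarrow> n \<ge> L' \<Longrightarrow> nrm (\<lambda>x. W m x - W n x) < e / (2 * M')"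
    using \<open>e > 0\<close> M' by (rule_tac cauchy_coeffsE[OF W, of "e / (2 * M')"]) auto
  note mem [simp] = cauchy_coeffs_mem[OF U] cauchy_coeffs_mem[OF W]
  define R where "R = max (max N N') (max L L')"
  have "dist (gram K (U m) (W m)) (gram K (U n) (W n)) < e" if "m \<ge> R" "n \<ge> R" for m n
  proof -
    have "gram K (U m) (W m) - gram K (U n) (W n)
        = gram K (\<lambda>x. U m x - U n x) (W m) + gram K (U n) (\<lambda>x. W m x - W n x)"
      by (simp add: gram_linear)
    moreover have "\<bar>gram K (\<lambda>x. U m x - U n x) (W m)\<bar> < e / 2"
    proof -
      have "\<bar>gram K (\<lambda>x. U m x - U n x) (W m)\<bar> \<le> nrm (\<lambda>x. U m x - U n x) * nrm (W m)"
        by (rule abs_gram_le) simp_all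
      also have "\<dots> \<le> nrm (\<lambda>x. U m x - U n x) * M"
        using that bnd[of m] by (intro mult_left_mono) (auto simp: R_def)
      also have "\<dots> < e / (2 * M) * M"
        using that M N'[of m n] by (intro mult_strict_right_mono) (auto simp: R_def)
      finally show ?thesis using M by simp
    qed
    moreover have "\<bar>gram K (U n) (\<lambda>x. W m x - W n x)\<bar> < e / 2"
    proof -
      have "\<bar>gram K (U n) (\<lambda>x. W m x - W n x)\<bar> \<le> nrm (U n) * nrm (\<lambda>x. W m x - W n x)"
        by (rule abs_gram_le) simp_all
      also have "\<dots> \<le> M' * nrm (\<lambda>x. W m x - W n x)"
        using that bnd'[of n] by (intro mult_right_mono) (auto simp: R_def)
      also have "\<dots> < M' * (e / (2 * M'))"
        using that M' L'[of m n] by (intro mult_strict_left_mono) (auto simp: R_def)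
      finally show ?thesis using M' by simp
    qed
    ultimately show ?thesis unfolding dist_real_def by linarith
  qed
  then show "\<exists>R. \<forall>m\<ge>R. \<forall>n\<ge>R. dist (gram K (U m) (W m)) (gram K (U n) (W n)) < e" by blast
qed

definition H :: "('a \<Rightarrow> real) set" where
  "H = {f. \<exists>U. represents U f}"

definition rep :: "('a \<Rightarrow> real) \<Rightarrow> nat \<Rightarrow> 'a \<Rightarrow> real" where
  "rep f = (SOME U. represents U f)"

definition ip :: "('a \<Rightarrow> real) \<Rightarrow> ('a \<Rightarrow> real) \<Rightarrow> real" where
  "ip f g = lim (\<lambda>n. gram K (rep f n) (rep g n))"

lemma represents_rep: "f \<in> H \<Longrightarrow> represents (rep f) f"
  unfolding H_def rep_def mem_Collect_eq by (rule someI_ex[of "\<lambda>U. represents U f"])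

text \<open>
  Any two sequences representing \<open>f\<close> and \<open>g\<close> may be used to compute \<open>\<langle>f, g\<rangle>\<close>: by
  \<open>gram_minus_pairing_tendsto\<close>, \<open>U\<close> can be exchanged for \<open>rep f\<close>, and then \<open>W\<close> for \<open>rep g\<close>. All
  algebraic laws of the inner product follow from this by passing to the limit in the Gram form.
\<close>

lemma gram_tendsto_ip:
  assumes U: "represents U f" and W: "represents W g"
  shows "(\<lambda>n. gram K (U n) (W n)) \<longlonglongrightarrow> ip f g"
proof -
  have U': "represents (rep f) f" and W': "represents (rep g) g"
    using U W by (auto intro!: represents_rep simp: H_def)
  note c = represents_cauchy
  have "(\<lambda>n. (gram K (U n) (W n) - pairing (W n) f)
           - (gram K (rep f n) (W n) - pairing (W n) f)
           + (gram K (W n) (rep f n) - pairing (rep f n) g)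
           - (gram K (rep g n) (rep f n) - pairing (rep f n) g)) \<longlonglongrightarrow> 0 - 0 + 0 - 0"
    by (intro tendsto_intros gram_minus_pairing_tendsto U W U' W' U[THEN c] W[THEN c]
        U'[THEN c] W'[THEN c])
  \<comment> \<open>the four pairings cancel, and by symmetry so do the two mixed Gram terms\<close>
  then have "(\<lambda>n. gram K (U n) (W n) - gram K (rep f n) (rep g n)) \<longlonglongrightarrow> 0"
    using W U' W' by (simp add: gram_sym represents_mem)
  moreover have "(\<lambda>n. gram K (rep f n) (rep g n)) \<longlonglongrightarrow> ip f g"
    using gram_convergent[OF U'[THEN c] W'[THEN c]] unfolding ip_def
    by (simp add: convergent_LIMSEQ_iff)
  ultimately show ?thesis
    using tendsto_add by fastforce
qed

definition embed :: "('a \<Rightarrow> real) \<Rightarrow> 'a \<Rightarrow> real" where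
  "embed u = (\<lambda>x\<in>S. pairing u (K x))"

lemma represents_embed:
  assumes "u \<in> V"
  shows "represents (\<lambda>n. u) (embed u)"
proof -
  have "nrm (\<lambda>x. u x - u x) = 0" by (simp add: nrm_def gram_def pairing_def)
  then show ?thesis using assms by (simp add: represents_def cauchy_coeffs_def embed_def)
qed

lemma represents_lincomb:
  assumes U: "represents U f" and W: "represents W g"
  shows "represents (\<lambda>n x. U n x + c * W n x) (\<lambda>x\<in>S. f x + c * g x)"
proof -
  note mem [simp] = represents_mem[OF U] represents_mem[OF W]
  have "\<exists>N. \<forall>m\<ge>N. \<forall>n\<ge>N. nrm (\<lambda>x. (U m x + c * W m x) - (U n x + c * W n x)) < e"
    if "e > 0" for e
  proof -
    obtain N where N: "\<And>m n. m \<ge> N \<Longrightarrow> n \<ge> N \<Longrightarrow> nrm (\<lambda>x. U m x - U n x) < e / 2"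
      using \<open>e > 0\<close> by (rule_tac cauchy_coeffsE[OF represents_cauchy[OF U], of "e / 2"]) auto
    have "e / (2 * (\<bar>c\<bar> + 1)) > 0" using \<open>e > 0\<close> by simp
    from cauchy_coeffsE[OF represents_cauchy[OF W] this]
    obtain N' where N': "\<And>m n. m \<ge> N' \<Longrightarrow> n \<ge> N' \<Longrightarrow>
        nrm (\<lambda>x. W m x - W n x) < e / (2 * (\<bar>c\<bar> + 1))"
      by blast
    have "nrm (\<lambda>x. (U m x + c * W m x) - (U n x + c * W n x)) < e"
      if "m \<ge> max N N'" "n \<ge> max N N'" for m n
    proof -
      have "(\<lambda>x. (U m x + c * W m x) - (U n x + c * W n x))
          = (\<lambda>x. (U m x - U n x) + c * (W m x - W n x))"
        by (simp add: algebra_simps)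
      then have "nrm (\<lambda>x. (U m x + c * W m x) - (U n x + c * W n x))
          \<le> nrm (\<lambda>x. U m x - U n x) + \<bar>c\<bar> * nrm (\<lambda>x. W m x - W n x)"
        using nrm_add_le[of "\<lambda>x. U m x - U n x" "\<lambda>x. c * (W m x - W n x)"]
          nrm_scale[of "\<lambda>x. W m x - W n x" c] by simp
      moreover have "\<bar>c\<bar> * nrm (\<lambda>x. W m x - W n x) \<le> (\<bar>c\<bar> + 1) * (e / (2 * (\<bar>c\<bar> + 1)))"
        using N'[of m n] that by (intro mult_mono) auto
      moreover have "(\<bar>c\<bar> + 1) * (e / (2 * (\<bar>c\<bar> + 1))) = e / 2"
        by (simp add: divide_simps)
      ultimately show ?thesis using N[of m n] that by simp
    qed
    then show ?thesis by blast
  qed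
  then have "cauchy_coeffs (\<lambda>n x. U n x + c * W n x)"
    by (simp add: cauchy_coeffs_def)
  moreover have "(\<lambda>n. pairing (\<lambda>x. U n x + c * W n x) (K t)) \<longlonglongrightarrow> f t + c * g t"
    if "t \<in> S" for t
  proof -
    have "pairing (\<lambda>x. U n x + c * W n x) (K t) = pairing (U n) (K t) + c * pairing (W n) (K t)"
      for n
      using pairing_lincomb_left[OF mem(1)[of n] mem(2)[of n], of 1 c] by simp
    then show ?thesis
      using U W that by (auto simp: represents_def intro!: tendsto_intros)
  qed
  ultimately show ?thesis by (simp add: represents_def)
qed

lemma H_lincomb: "f \<in> H \<Longrightarrow> g \<in> H \<Longrightarrow> (\<lambda>x\<in>S. f x + c * g x) \<in> H"
  using represents_lincomb by (force simp: H_def)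

lemma ip_lincomb:
  assumes "f \<in> H" "g \<in> H" "h \<in> H"
  shows "ip (\<lambda>x\<in>S. f x + c * g x) h = ip f h + c * ip g h"
proof (rule LIMSEQ_unique)
  note r = assms[THEN represents_rep]
  show "(\<lambda>n. gram K (\<lambda>x. rep f n x + c * rep g n x) (rep h n))
      \<longlonglongrightarrow> ip (\<lambda>x\<in>S. f x + c * g x) h"
    by (intro gram_tendsto_ip represents_lincomb r)
  have "(\<lambda>n. gram K (rep f n) (rep h n) + c * gram K (rep g n) (rep h n))
      \<longlonglongrightarrow> ip f h + c * ip g h"
    by (intro tendsto_intros gram_tendsto_ip r)
  then show "(\<lambda>n. gram K (\<lambda>x. rep f n x + c * rep g n x) (rep h n))
      \<longlonglongrightarrow> ip f h + c * ip g h"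
    by (simp add: gram_linear represents_mem[OF r(1)] represents_mem[OF r(2)])
qed

definition distH :: "('a \<Rightarrow> real) \<Rightarrow> ('a \<Rightarrow> real) \<Rightarrow> real" where
  "distH f g = sqrt (ip (\<lambda>x\<in>S. f x - g x) (\<lambda>x\<in>S. f x - g x))"

lemma nrm_diff_tendsto_distH:
  assumes "represents U f" "represents W g"
  shows "(\<lambda>n. nrm (\<lambda>x. U n x - W n x)) \<longlonglongrightarrow> distH f g"
proof -
  have "represents (\<lambda>n x. U n x - W n x) (\<lambda>x\<in>S. f x - g x)"
    using represents_lincomb[OF assms, of "-1"] by simp
  then show ?thesis
    unfolding nrm_def distH_def by (intro tendsto_real_sqrt gram_tendsto_ip)
qed

lemma distH_triangle:
  assumes "f \<in> H" "g \<in> H" "h \<in> H"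
  shows "distH f h \<le> distH f g + distH g h"
proof (rule LIMSEQ_le)
  note r = assms[THEN represents_rep]
  show "(\<lambda>n. nrm (\<lambda>x. rep f n x - rep h n x)) \<longlonglongrightarrow> distH f h"
    by (intro nrm_diff_tendsto_distH r)
  show "(\<lambda>n. nrm (\<lambda>x. rep f n x - rep g n x) + nrm (\<lambda>x. rep g n x - rep h n x))
      \<longlonglongrightarrow> distH f g + distH g h"
    by (intro tendsto_add nrm_diff_tendsto_distH r)
  show "\<exists>N. \<forall>n\<ge>N. nrm (\<lambda>x. rep f n x - rep h n x)
      \<le> nrm (\<lambda>x. rep f n x - rep g n x) + nrm (\<lambda>x. rep g n x - rep h n x)"
    using nrm_triangle r represents_mem by blast
qed

lemma distH_commute:
  assumes "f \<in> H" "g \<in> H"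
  shows "distH f g = distH g f"
proof (rule LIMSEQ_unique)
  note r = assms[THEN represents_rep]
  show "(\<lambda>n. nrm (\<lambda>x. rep f n x - rep g n x)) \<longlonglongrightarrow> distH f g"
    by (intro nrm_diff_tendsto_distH r)
  show "(\<lambda>n. nrm (\<lambda>x. rep f n x - rep g n x)) \<longlonglongrightarrow> distH g f"
    using nrm_diff_tendsto_distH[OF r(2,1)]
    by (simp add: nrm_diff_commute[OF represents_mem[OF r(1)] represents_mem[OF r(2)]])
qed

lemma embed_mem: "u \<in> V \<Longrightarrow> embed u \<in> H"
  using represents_embed by (auto simp: H_def)

lemma zero_mem_H: "(\<lambda>x\<in>S. 0) \<in> H"
  using embed_mem[of "\<lambda>x. 0"] by (simp add: embed_def pairing_def)

lemma distH_embed_le: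
  assumes U: "represents U f" and "v \<in> V" and le: "\<And>m. m \<ge> N \<Longrightarrow> nrm (\<lambda>x. U m x - v x) \<le> e"
  shows "distH f (embed v) \<le> e"
  using nrm_diff_tendsto_distH[OF U represents_embed[OF \<open>v \<in> V\<close>]] le
  by (intro LIMSEQ_le_const2) auto

lemma distH_embed:
  assumes "u \<in> V" "v \<in> V"
  shows "distH (embed u) (embed v) = nrm (\<lambda>x. u x - v x)"
  using nrm_diff_tendsto_distH[OF assms[THEN represents_embed]] by (simp add: LIMSEQ_const_iff)

lemma embed_dense:
  assumes "f \<in> H" "e > 0"
  obtains v where "v \<in> V" "distH f (embed v) \<le> e"
proof -
  have r: "represents (rep f) f" using assms by (simp add: represents_rep)
  obtain N where "\<And>m n. m \<ge> N \<Longrightarrow> n \<ge> N \<Longrightarrow> nrm (\<lambda>x. rep f m x - rep f n x) < e"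
    using cauchy_coeffsE[OF represents_cauchy[OF r] \<open>e > 0\<close>] by blast
  then have "distH f (embed (rep f N)) \<le> e"
    by (intro distH_embed_le[OF r represents_mem[OF r], of N]) (simp add: less_imp_le)
  then show ?thesis using that represents_mem[OF r] by blast
qed

lemma cauchy_coeffs_represents:
  assumes U: "cauchy_coeffs U"
  obtains f where "represents U f"
proof -
  have "convergent (\<lambda>n. pairing (U n) (K t))" if "t \<in> S" for t
  proof -
    have "cauchy_coeffs (\<lambda>n. point_mass t)"
      using represents_cauchy[OF represents_embed[of "point_mass t"]] that by simp
    from gram_convergent[OF this U] show ?thesis by (simp add: gram_def)
  qed
  then have "represents U (\<lambda>t\<in>S. lim (\<lambda>n. pairing (U n) (K t)))"
    using U by (simp add: represents_def convergent_LIMSEQ_iff)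
  then show ?thesis using that by blast
qed

text \<open>
  Each \<open>F\<^sub>n\<close> is approximated within \<open>1 / (n + 1)\<close> by a combination of kernel sections. The coefficients
  of these approximations form a Cauchy sequence, and the function that it represents is the limit.
\<close>

lemma H_complete:
  assumes F: "\<And>n. F n \<in> H"
    and cauchy: "\<And>e. e > 0 \<Longrightarrow> \<exists>N. \<forall>m\<ge>N. \<forall>n\<ge>N. distH (F m) (F n) < e"
  shows "\<exists>f\<in>H. (\<lambda>n. distH (F n) f) \<longlonglongrightarrow> 0"
proof -
  have "\<exists>v\<in>V. distH (F n) (embed v) \<le> 1 / real (Suc n)" for n
    using embed_dense[OF F[of n], of "1 / real (Suc n)"] by auto
  then obtain v where v [simp]: "\<And>n. v n \<in> V"
    and close: "\<And>n. distH (F n) (embed (v n)) \<le> 1 / real (Suc n)"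
    by metis
  note mem = F embed_mem[OF v]
  have small: "\<exists>N. \<forall>n\<ge>N. 1 / real (Suc n) < e" if e: "e > 0" for e
  proof -
    obtain N where N: "1 / real (Suc N) < e" using e nat_approx_posE by blast
    have "1 / real (Suc n) \<le> 1 / real (Suc N)" if "n \<ge> N" for n
      using that by (simp add: frac_le)
    then show ?thesis using N by (meson le_less_trans)
  qed
  have "\<exists>N. \<forall>m\<ge>N. \<forall>n\<ge>N. nrm (\<lambda>x. v m x - v n x) < e" if "e > 0" for e
  proof -
    obtain N where N: "\<And>m n. m \<ge> N \<Longrightarrow> n \<ge> N \<Longrightarrow> distH (F m) (F n) < e / 3"
      using cauchy[of "e / 3"] \<open>e > 0\<close> by auto
    obtain N' where N': "\<And>n. n \<ge> N' \<Longrightarrow> 1 / real (Suc n) < e / 3"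
      using small[of "e / 3"] \<open>e > 0\<close> by auto
    have "nrm (\<lambda>x. v m x - v n x) < e" if "m \<ge> max N N'" "n \<ge> max N N'" for m n
    proof -
      have "nrm (\<lambda>x. v m x - v n x) = distH (embed (v m)) (embed (v n))"
        by (simp add: distH_embed)
      also have "\<dots> \<le> distH (embed (v m)) (F m) + (distH (F m) (F n) + distH (F n) (embed (v n)))"
        using distH_triangle[OF mem(2)[of m] mem(1)[of m] mem(2)[of n]]
          distH_triangle[OF mem(1)[of m] mem(1)[of n] mem(2)[of n]] by linarith
      also have "distH (embed (v m)) (F m) = distH (F m) (embed (v m))"
        by (intro distH_commute mem)
      finally show ?thesis
        using that N[of m n] N'[of m] N'[of n] close[of m] close[of n] by linarith
    qed
    then show ?thesis by blast
  qed
  then have cv: "cauchy_coeffs v" by (simp add: cauchy_coeffs_def)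
  then obtain f where f: "represents v f" by (rule cauchy_coeffs_represents)
  have fH: "f \<in> H" using f by (auto simp: H_def)
  have "(\<lambda>n. distH (F n) f) \<longlonglongrightarrow> 0"
  proof (rule LIMSEQ_I)
    fix e :: real assume "e > 0"
    obtain N where N: "\<And>m n. m \<ge> N \<Longrightarrow> n \<ge> N \<Longrightarrow> nrm (\<lambda>x. v m x - v n x) < e / 2"
      using \<open>e > 0\<close> by (rule_tac cauchy_coeffsE[OF cv, of "e / 2"]) auto
    obtain N' where N': "\<And>n. n \<ge> N' \<Longrightarrow> 1 / real (Suc n) < e / 2"
      using small[of "e / 2"] \<open>e > 0\<close> by auto
    have "norm (distH (F n) f - 0) < e" if n: "n \<ge> max N N'" for n
    proof -
      have "distH f (embed (v n)) \<le> e / 2"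
        using N n by (intro distH_embed_le[OF f, of _ N]) (auto simp: less_imp_le)
      moreover have "distH (F n) f \<le> distH (F n) (embed (v n)) + distH (embed (v n)) f"
        by (intro distH_triangle mem fH)
      moreover have "distH (embed (v n)) f = distH f (embed (v n))"
        by (intro distH_commute mem fH)
      moreover have "distH (F n) f \<ge> 0"
        using nrm_diff_tendsto_distH[OF represents_rep[OF F[of n]] f]
          represents_mem[OF represents_rep[OF F[of n]]] v
        by (intro LIMSEQ_le_const[of _ "distH (F n) f"]) auto
      ultimately show ?thesis using n N'[of n] close[of n] by simp
    qed
    then show "\<exists>no. \<forall>n\<ge>no. norm (distH (F n) f - 0) < e" by blast
  qed
  then show ?thesis using fH by blast
qed

lemma embed_point_mass: "t \<in> S \<Longrightarrow> embed (point_mass t) = (\<lambda>x\<in>S. K t x)"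
  by (auto simp: embed_def kernel_commute)

lemma ip_reproducing:
  assumes "f \<in> H" "t \<in> S"
  shows "ip f (\<lambda>x\<in>S. K t x) = f t"
proof (rule LIMSEQ_unique)
  note r = represents_rep[OF assms(1)]
  show "(\<lambda>n. gram K (rep f n) (point_mass t)) \<longlonglongrightarrow> ip f (\<lambda>x\<in>S. K t x)"
    using gram_tendsto_ip[OF r represents_embed[of "point_mass t"]] assms
    by (simp add: embed_point_mass)
  show "(\<lambda>n. gram K (rep f n) (point_mass t)) \<longlonglongrightarrow> f t"
    using pairing_tendsto[OF r, of "point_mass t"] assms represents_mem[OF r]
    by (simp add: gram_sym[of "point_mass t"])
qed

text \<open>
  The values of \<open>f\<close> are inner products with kernel sections, so a function of norm zero vanishes
  pointwise. In this way the null vectors of the semi-norm disappear without a quotient being formed.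
\<close>

lemma ip_definite:
  assumes f: "f \<in> H" and zero: "ip f f = 0"
  shows "f = (\<lambda>x\<in>S. 0)"
proof
  note r = represents_rep[OF f]
  fix t
  have "f t = 0" if t: "t \<in> S"
  proof -
    have "(\<lambda>n. nrm (rep f n) * nrm (point_mass t)) \<longlonglongrightarrow> sqrt (ip f f) * nrm (point_mass t)"
      unfolding nrm_def[of "rep f _"] by (intro tendsto_intros gram_tendsto_ip r)
    then have lim0: "(\<lambda>n. nrm (rep f n) * nrm (point_mass t)) \<longlonglongrightarrow> 0"
      using zero by simp
    have "(\<lambda>n. gram K (point_mass t) (rep f n)) \<longlonglongrightarrow> 0"
      using abs_gram_le[of "point_mass t"] represents_mem[OF r] t
      by (intro Lim_null_comparison[OF _ lim0] always_eventually) (simp add: mult.commute[of "nrm (rep f _)"])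
    moreover have "(\<lambda>n. gram K (point_mass t) (rep f n)) \<longlonglongrightarrow> f t"
      using pairing_tendsto[OF r, of "point_mass t"] t by simp
    ultimately show ?thesis by (rule LIMSEQ_unique[symmetric])
  qed
  moreover have "f \<in> extensional S" using r by (simp add: represents_def)
  ultimately show "f t = (\<lambda>x\<in>S. 0) t" by (auto simp: extensional_def)
qed

theorem moore_aronszajn: "reproducing_kernel_hilbert_space S K H ip"
proof unfold_locales
  show "H \<subseteq> extensional S" by (auto simp: H_def represents_def)
  show "(\<lambda>x\<in>S. 0) \<in> H" by (rule zero_mem_H)
  fix f g h c
  assume f: "f \<in> H" and g: "g \<in> H"
  show "(\<lambda>x\<in>S. f x + g x) \<in> H" using H_lincomb[OF f g, of 1] by simp
  show "ip f g = ip g f"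
  proof (rule LIMSEQ_unique)
    show "(\<lambda>n. gram K (rep f n) (rep g n)) \<longlonglongrightarrow> ip f g"
      by (intro gram_tendsto_ip represents_rep f g)
    show "(\<lambda>n. gram K (rep f n) (rep g n)) \<longlonglongrightarrow> ip g f"
      using gram_tendsto_ip[OF g[THEN represents_rep] f[THEN represents_rep]]
      by (simp add: gram_sym[of "rep f _"] represents_mem[OF f[THEN represents_rep]]
          represents_mem[OF g[THEN represents_rep]])
  qed
  show "ip (\<lambda>x\<in>S. f x + g x) h = ip f h + ip g h" if "h \<in> H"
    using ip_lincomb[OF f g that, of 1] by simp
next
  fix f g c assume f: "f \<in> H"
  have eq: "(\<lambda>x\<in>S. (\<lambda>x\<in>S. 0) x + c * f x) = (\<lambda>x\<in>S. c * f x)" by auto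
  show "(\<lambda>x\<in>S. c * f x) \<in> H" using H_lincomb[OF zero_mem_H f, of c] unfolding eq .
  show "ip (\<lambda>x\<in>S. c * f x) g = c * ip f g" if g: "g \<in> H"
  proof -
    have "(\<lambda>x\<in>S. (\<lambda>x\<in>S. 0) x + 1 * (\<lambda>x\<in>S. 0) x) = (\<lambda>x\<in>S. 0 :: real)" by auto
    then have "ip (\<lambda>x\<in>S. 0) g = 0" using ip_lincomb[OF zero_mem_H zero_mem_H g, of 1] by simp
    then show ?thesis using ip_lincomb[OF zero_mem_H f g, of c] unfolding eq by simp
  qed
  note r = represents_rep[OF f]
  show "ip f f \<ge> 0"
    using gram_tendsto_ip[OF r r] represents_mem[OF r] gram_nonneg
    by (intro LIMSEQ_le_const[of _ "ip f f"]) auto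
  show "ip f f = 0 \<Longrightarrow> f = (\<lambda>x\<in>S. 0)" by (rule ip_definite[OF f])
next
  fix F :: "nat \<Rightarrow> 'a \<Rightarrow> real"
  assume "\<forall>n. F n \<in> H" and "\<forall>e>0. \<exists>N. \<forall>m\<ge>N. \<forall>n\<ge>N.
    sqrt (ip (\<lambda>x\<in>S. F m x - F n x) (\<lambda>x\<in>S. F m x - F n x)) < e"
  then show "\<exists>f\<in>H. (\<lambda>n. sqrt (ip (\<lambda>x\<in>S. F n x - f x) (\<lambda>x\<in>S. F n x - f x))) \<longlonglongrightarrow> 0"
    using H_complete[of F] by (simp add: distH_def)
next
  fix t assume t: "t \<in> S"
  then show "(\<lambda>x\<in>S. K t x) \<in> H" using embed_mem[of "point_mass t"] by (simp add: embed_point_mass)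
  show "ip f (\<lambda>x\<in>S. K t x) = f t" if "f \<in> H" for f using that t by (rule ip_reproducing)
qed

end

section \<open>Operations on covariances\<close>

lemma covariance_on_cong:
  assumes "\<And>s t. s \<in> S \<Longrightarrow> t \<in> S \<Longrightarrow> K s t = K' s t"
  shows "covariance_on S K \<longleftrightarrow> covariance_on S K'"
proof -
  have "gram K u u = gram K' u u" if "u \<in> finsupp S" for u
    unfolding gram_def using that assms by (intro pairing_cong[of u S]) auto
  then show ?thesis using assms by (auto simp: covariance_on_iff_gram)
qed

lemma covariance_on_mono: "covariance_on T K \<Longrightarrow> S \<subseteq> T \<Longrightarrow> covariance_on S K"
  unfolding covariance_on_iff_gram using finsupp_mono by blast

lemma covariance_on_add:
  assumes "covariance_on S K" "covariance_on S L"
  shows "covariance_on S (\<lambda>s t. K s t + L s t)"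
proof -
  have "gram (\<lambda>s t. K s t + L s t) u u = gram K u u + gram L u u" for u
    by (simp add: gram_eq_sum sum.distrib algebra_simps)
  then show ?thesis using assms by (auto simp: covariance_on_iff_gram)
qed

text \<open>
  Outside \<open>S\<close> the coefficients do not contribute, so the quadratic form is that of \<open>K\<close> at the
  coefficients cut off to \<open>S\<close>.
\<close>

lemma covariance_on_extend_zero:
  assumes "covariance_on S K"
  shows "covariance_on T (\<lambda>s t. if s \<in> S \<and> t \<in> S then K s t else 0)"
  unfolding covariance_on_iff_gram
proof (intro conjI ballI)
  let ?K = "\<lambda>s t. if s \<in> S \<and> t \<in> S then K s t else 0"
  show "?K s t = ?K t s" for s t
    using assms by (auto simp: covariance_on_def)
  fix u assume u: "u \<in> finsupp T"
  define v where "v = (\<lambda>x. if x \<in> S then u x else 0)"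
  have fin: "finite {x. u x \<noteq> 0}" using u by (simp add: finsupp_def)
  have sub: "{x. v x \<noteq> 0} \<subseteq> {x. u x \<noteq> 0}" by (auto simp: v_def)
  have v: "v \<in> finsupp S"
    using finite_subset[OF sub fin] by (auto simp: finsupp_def v_def)
  have pair: "pairing u (\<lambda>x. if x \<in> S then f x else 0) = pairing v f" for f
    unfolding pairing_superset[OF fin sub] pairing_superset[OF fin order_refl]
    by (intro sum.cong) (auto simp: v_def)
  have "gram ?K u u = pairing u (\<lambda>x. if x \<in> S then pairing v (K x) else 0)"
    unfolding gram_def pair[symmetric] by (intro pairing_cong[OF u]) (simp add: pairing_def)
  then have "gram ?K u u = gram K v v" by (simp add: pair gram_def)
  then show "gram ?K u u \<ge> 0" using assms v by (simp add: covariance_on_iff_gram)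
qed

section \<open>Hilbert spaces of functions\<close>

context function_hilbert_space
begin

lemma diff_mem: "f \<in> H \<Longrightarrow> g \<in> H \<Longrightarrow> (\<lambda>x\<in>S. f x - g x) \<in> H"
  using add_mem[of f "\<lambda>x\<in>S. -1 * g x"] scale_mem[of g "-1"]
  by (simp add: restrict_def cong: if_cong)

lemma ip_diff_left:
  assumes "f \<in> H" "g \<in> H" "h \<in> H"
  shows "ip (\<lambda>x\<in>S. f x - g x) h = ip f h - ip g h"
proof -
  have "(\<lambda>x\<in>S. f x - g x) = (\<lambda>x\<in>S. f x + (\<lambda>x\<in>S. -1 * g x) x)" by auto
  then show ?thesis
    using assms ip_add_left[of f "\<lambda>x\<in>S. -1 * g x" h] scale_mem[of g "-1"]
      ip_scale_left[of g h "-1"] by simp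
qed

lemma ip_cauchy_schwarz:
  assumes f: "f \<in> H" and g: "g \<in> H"
  shows "\<bar>ip f g\<bar> \<le> sqrt (ip f f) * sqrt (ip g g)"
proof -
  have "(ip f g)\<^sup>2 \<le> ip f f * ip g g"
  proof (rule nonneg_quadratic_imp_discriminant)
    fix c
    let ?cg = "\<lambda>x\<in>S. c * g x"
    let ?h = "\<lambda>x\<in>S. f x + ?cg x"
    have cg: "?cg \<in> H" by (rule scale_mem[OF g])
    have h: "?h \<in> H" by (rule add_mem[OF f cg])
    have "0 \<le> ip ?h ?h" by (rule ip_nonneg[OF h])
    also have "ip ?h ?h = ip f ?h + c * ip g ?h"
      unfolding ip_add_left[OF f cg h] ip_scale_left[OF g h] ..
    also have "ip f ?h = ip f f + c * ip f g"
      unfolding ip_commute[OF f h] ip_add_left[OF f cg f] ip_scale_left[OF g f]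
      using ip_commute[OF f g] by simp
    also have "ip g ?h = ip f g + c * ip g g"
      unfolding ip_commute[OF g h] ip_add_left[OF f cg g] ip_scale_left[OF g g] ..
    finally show "0 \<le> ip f f + 2 * c * ip f g + c\<^sup>2 * ip g g"
      by (simp add: power2_eq_square algebra_simps)
  qed (rule ip_nonneg[OF g])
  then have "sqrt ((ip f g)\<^sup>2) \<le> sqrt (ip f f * ip g g)" by (rule real_sqrt_le_mono)
  then show ?thesis by (simp add: real_sqrt_mult)
qed

lemma sum_mem_ip:
  assumes "finite F" "\<And>s. s \<in> F \<Longrightarrow> k s \<in> H"
  shows "(\<lambda>x\<in>S. \<Sum>s\<in>F. c s * k s x) \<in> H \<and>
    (\<forall>g\<in>H. ip (\<lambda>x\<in>S. \<Sum>s\<in>F. c s * k s x) g = (\<Sum>s\<in>F. c s * ip (k s) g))"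
  using assms
proof (induction F)
  case empty
  have "ip (\<lambda>x\<in>S. 0) g = 0" if "g \<in> H" for g
  proof -
    have "(\<lambda>x\<in>S. 0 * (\<lambda>x\<in>S. 0) x) = (\<lambda>x\<in>S. 0 :: real)" by auto
    then show ?thesis using ip_scale_left[OF zero_mem that, of 0] by simp
  qed
  then show ?case using zero_mem unfolding sum.empty by blast
next
  case (insert s F)
  let ?a = "\<lambda>x\<in>S. c s * k s x" and ?b = "\<lambda>x\<in>S. \<Sum>s\<in>F. c s * k s x"
  have a: "?a \<in> H" using insert.prems by (intro scale_mem) simp
  have b: "?b \<in> H" and ip_b: "\<And>g. g \<in> H \<Longrightarrow> ip ?b g = (\<Sum>s\<in>F. c s * ip (k s) g)"
    using insert.IH insert.prems by blast+
  have eq: "(\<lambda>x\<in>S. \<Sum>s\<in>insert s F. c s * k s x) = (\<lambda>x\<in>S. ?a x + ?b x)"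
    using insert.hyps by auto
  have "ip (\<lambda>x\<in>S. ?a x + ?b x) g = (\<Sum>s\<in>insert s F. c s * ip (k s) g)" if "g \<in> H" for g
    unfolding ip_add_left[OF a b that] ip_b[OF that] using insert.hyps insert.prems that
    by (simp add: ip_scale_left)
  then show ?case unfolding eq using add_mem[OF a b] by blast
qed

lemma pairing_mem:
  assumes "u \<in> finsupp T" "\<And>s. s \<in> T \<Longrightarrow> k s \<in> H"
  shows "(\<lambda>x\<in>S. pairing u (\<lambda>s. k s x)) \<in> H"
  unfolding pairing_def using assms
  by (intro sum_mem_ip[THEN conjunct1]) (auto simp: finsupp_def)

lemma ip_pairing_left:
  assumes "u \<in> finsupp T" "\<And>s. s \<in> T \<Longrightarrow> k s \<in> H" "g \<in> H"
  shows "ip (\<lambda>x\<in>S. pairing u (\<lambda>s. k s x)) g = pairing u (\<lambda>s. ip (k s) g)"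
  unfolding pairing_def using assms
  by (intro sum_mem_ip[THEN conjunct2, rule_format]) (auto simp: finsupp_def)

text \<open>
  The quadratic form of the kernel \<open>\<langle>k\<^sub>s, k\<^sub>t\<rangle>\<close> is a squared norm; this is what makes such a kernel a
  covariance, and it converts norm inequalities into inequalities between covariances.
\<close>

lemma gram_feature_map:
  assumes u: "u \<in> finsupp T" and k: "\<And>s. s \<in> T \<Longrightarrow> k s \<in> H"
  shows "gram (\<lambda>s t. ip (k s) (k t)) u u
    = ip (\<lambda>x\<in>S. pairing u (\<lambda>s. k s x)) (\<lambda>x\<in>S. pairing u (\<lambda>s. k s x))"
proof -
  let ?f = "\<lambda>x\<in>S. pairing u (\<lambda>s. k s x)"
  have f: "?f \<in> H" by (rule pairing_mem[OF u k])
  have "ip ?f ?f = pairing u (\<lambda>s. ip (k s) ?f)" by (rule ip_pairing_left[OF u k f])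
  also have "\<dots> = pairing u (\<lambda>s. ip ?f (k s))"
    using f k by (intro pairing_cong[OF u] ip_commute)
  also have "\<dots> = pairing u (\<lambda>s. pairing u (\<lambda>t. ip (k t) (k s)))"
    using k by (intro pairing_cong[OF u] ip_pairing_left[OF u k])
  also have "\<dots> = gram (\<lambda>s t. ip (k s) (k t)) u u"
    unfolding gram_def using k by (intro pairing_cong[OF u] ip_commute)
  finally show ?thesis ..
qed

lemma covariance_on_feature_map:
  assumes k: "\<And>s. s \<in> T \<Longrightarrow> k s \<in> H"
  shows "covariance_on T (\<lambda>s t. ip (k s) (k t))"
  unfolding covariance_on_iff_gram
proof (intro conjI ballI)
  show "gram (\<lambda>s t. ip (k s) (k t)) u u \<ge> 0" if "u \<in> finsupp T" for u
    using gram_feature_map[OF that k] ip_nonneg pairing_mem[OF that k] by simp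
qed (use k ip_commute in blast)

end

section \<open>Restriction to a subset and Schur complements\<close>

lemma reproducing_kernel_hilbert_space_cong:
  assumes "reproducing_kernel_hilbert_space S K H ip"
    and eq: "\<And>s t. s \<in> S \<Longrightarrow> t \<in> S \<Longrightarrow> K s t = K' s t"
  shows "reproducing_kernel_hilbert_space S K' H ip"
proof -
  interpret reproducing_kernel_hilbert_space S K H ip by fact
  have "(\<lambda>x\<in>S. K' t x) = (\<lambda>x\<in>S. K t x)" if "t \<in> S" for t
    using eq that by (auto simp: restrict_def)
  then show ?thesis by unfold_locales (auto simp: kernel_mem reproducing)
qed

lemma reproducing_kernel_hilbert_space_rkhs:
  assumes "covariance_on S K"
  shows "reproducing_kernel_hilbert_space S K (fst (rkhs S K)) (snd (rkhs S K))"
proof -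
  interpret covariance_kernel S K by unfold_locales fact
  have "\<exists>p. reproducing_kernel_hilbert_space S K (fst p) (snd p)"
    using moore_aronszajn by (intro exI[of _ "(H, ip)"]) simp
  from someI_ex[OF this] show ?thesis unfolding rkhs_def case_prod_unfold .
qed

context reproducing_kernel_hilbert_space
begin

lemma kernel_symmetric: "s \<in> S \<Longrightarrow> t \<in> S \<Longrightarrow> K s t = K t s"
  using reproducing[OF kernel_mem, of s t] reproducing[OF kernel_mem, of t s]
    ip_commute[OF kernel_mem kernel_mem, of s t] by simp

text \<open>
  Combinations of kernel sections at points of \<open>S\<close> lie in the space, and the reproducing property
  extends to them by linearity. In particular their inner products are given by the Gram form
  (\<open>ip_embedding_embedding\<close>), for whichever Hilbert space with reproducing kernel \<open>K\<close>.
\<close>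

lemma embedding:
  assumes u: "u \<in> finsupp S"
  shows embedding_mem: "(\<lambda>x\<in>S. pairing u (K x)) \<in> H"
    and ip_embedding: "g \<in> H \<Longrightarrow> ip (\<lambda>x\<in>S. pairing u (K x)) g = pairing u g"
proof -
  have eq: "(\<lambda>x\<in>S. pairing u (K x)) = (\<lambda>x\<in>S. pairing u (\<lambda>s. (\<lambda>y\<in>S. K s y) x))"
    using kernel_symmetric by (intro restrict_ext pairing_cong[OF u]) simp
  show "(\<lambda>x\<in>S. pairing u (K x)) \<in> H"
    unfolding eq by (rule pairing_mem[OF u kernel_mem])
  assume g: "g \<in> H"
  have "ip (\<lambda>x\<in>S. pairing u (K x)) g = pairing u (\<lambda>s. ip (\<lambda>y\<in>S. K s y) g)"
    unfolding eq by (rule ip_pairing_left[OF u kernel_mem g])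
  also have "\<dots> = pairing u g"
    using g reproducing ip_commute kernel_mem by (intro pairing_cong[OF u]) metis
  finally show "ip (\<lambda>x\<in>S. pairing u (K x)) g = pairing u g" .
qed

lemma ip_embedding_embedding:
  assumes "u \<in> finsupp S" "v \<in> finsupp S"
  shows "ip (\<lambda>x\<in>S. pairing u (K x)) (\<lambda>x\<in>S. pairing v (K x)) = gram K u v"
  unfolding ip_embedding[OF assms(1) embedding_mem[OF assms(2)]] gram_def
  by (rule pairing_cong[OF assms(1)]) simp

text \<open>
  The combination \<open>w\<close> of kernel sections at points of \<open>B\<close> is projected orthogonally onto the span of
  the sections at points of \<open>S\<close>, without a Hilbert space on \<open>B\<close>. Coefficients \<open>U\<^sub>n\<close> on \<open>S\<close> that
  minimise \<open>\<parallel>w - U\<^sub>n\<parallel>\<^sup>2\<close> asymptotically are Cauchy by the parallelogram law, and the Gram form on \<open>S\<close> is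
  the inner product of the given Hilbert space, so they converge there to some \<open>g\<close>. Near-minimality
  makes \<open>w - U\<^sub>n\<close> nearly orthogonal to each section at \<open>t \<in> S\<close>, that is, the functions \<open>w\<close> and
  \<open>U\<^sub>n\<close> nearly agree at \<open>t\<close>; therefore \<open>g\<close> is the restriction of \<open>w\<close>. The norm bound is the limit of
  \<open>0 \<le> \<parallel>w - U\<^sub>n\<parallel>\<^sup>2\<close>.
\<close>

theorem restriction_contraction:
  assumes cov: "covariance_on B K" and sub: "S \<subseteq> B" and w: "w \<in> finsupp B"
  shows "(\<lambda>x\<in>S. pairing w (K x)) \<in> H"
    and "ip (\<lambda>x\<in>S. pairing w (K x)) (\<lambda>x\<in>S. pairing w (K x)) \<le> gram K w w"
proof -
  interpret B: covariance_kernel B K by unfold_locales fact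
  define dev where "dev = (\<lambda>u. gram K (\<lambda>x. w x - u x) (\<lambda>x. w x - u x))"
  define D where "D = (INF u\<in>finsupp S. dev u)"
  note [simp] = w finsupp_mono[OF sub]
  have dev_nonneg: "dev u \<ge> 0" if "u \<in> finsupp S" for u
    unfolding dev_def using that by (intro B.gram_nonneg) simp
  have bdd: "bdd_below (dev ` finsupp S)" using dev_nonneg by (auto intro!: bdd_belowI[of _ 0])
  have D_le: "D \<le> dev u" if "u \<in> finsupp S" for u
    unfolding D_def by (rule cINF_lower[OF bdd that])
  have "\<exists>u\<in>finsupp S. dev u < D + 1 / real (Suc n)" for n
  proof -
    have "finsupp S \<noteq> {}" using finsupp_zero by blast
    moreover have "(INF u\<in>finsupp S. dev u) < D + 1 / real (Suc n)"
      unfolding D_def[symmetric] by simp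
    ultimately show ?thesis using cINF_less_iff[OF _ bdd] by blast
  qed
  then obtain U where U [simp]: "\<And>n. U n \<in> finsupp S"
    and dev_U: "\<And>n. dev (U n) < D + 1 / real (Suc n)"
    by metis
  define f where "f n = (\<lambda>x\<in>S. pairing (U n) (K x))" for n
  have f: "f n \<in> H" for n unfolding f_def by (intro embedding_mem U)
  have dev_eq: "dev u = gram K w w - 2 * gram K w u + gram K u u" if "u \<in> finsupp S" for u
    unfolding dev_def using that by (simp add: B.gram_linear B.gram_sym[of u w])
  have close: "gram K (\<lambda>x. U m x - U n x) (\<lambda>x. U m x - U n x)
      \<le> 2 / real (Suc m) + 2 / real (Suc n)" for m n
  proof -
    \<comment> \<open>parallelogram law for \<open>w - U m\<close> and \<open>w - U n\<close>, whose mean is \<open>w - mid\<close>\<close>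
    define mid where "mid = (\<lambda>x. 1 / 2 * (U m x + U n x))"
    have mid: "mid \<in> finsupp S" unfolding mid_def by (intro finsupp_scale finsupp_add U)
    have "dev mid = gram K w w - (gram K w (U m) + gram K w (U n))
        + (gram K (U m) (U m) + 2 * gram K (U m) (U n) + gram K (U n) (U n)) / 4"
      unfolding dev_eq[OF mid] unfolding mid_def
      by (simp add: B.gram_linear B.gram_sym[of "U n" "U m"]
          del: times_divide_eq_left mult_1_left) (simp add: field_simps)
    moreover have "gram K (\<lambda>x. U m x - U n x) (\<lambda>x. U m x - U n x)
        = gram K (U m) (U m) - 2 * gram K (U m) (U n) + gram K (U n) (U n)"
      by (simp add: B.gram_linear B.gram_sym[of "U n" "U m"])
    ultimately have "gram K (\<lambda>x. U m x - U n x) (\<lambda>x. U m x - U n x)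
        = 2 * dev (U m) + 2 * dev (U n) - 4 * dev mid"
      by (simp add: dev_eq field_simps)
    also have "\<dots> \<le> 2 * (D + 1 / real (Suc m)) + 2 * (D + 1 / real (Suc n)) - 4 * D"
      using dev_U[of m] dev_U[of n] D_le[OF mid]
      by (intro add_mono diff_mono mult_left_mono) auto
    finally show ?thesis by (simp add: algebra_simps)
  qed
  have "\<exists>N. \<forall>m\<ge>N. \<forall>n\<ge>N. sqrt (ip (\<lambda>x\<in>S. f m x - f n x) (\<lambda>x\<in>S. f m x - f n x)) < e"
    if "e > 0" for e
  proof -
    have "e\<^sup>2 / 4 > 0" using \<open>e > 0\<close> by simp
    then obtain N where N: "1 / real (Suc N) < e\<^sup>2 / 4" using nat_approx_posE by blast
    have "sqrt (ip (\<lambda>x\<in>S. f m x - f n x) (\<lambda>x\<in>S. f m x - f n x)) < e"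
      if "m \<ge> N" "n \<ge> N" for m n
    proof -
      have eq: "(\<lambda>x\<in>S. f m x - f n x) = (\<lambda>x\<in>S. pairing (\<lambda>x. U m x - U n x) (K x))"
        using pairing_lincomb_left[OF U[of m] U[of n], of 1 "-1"] by (auto simp: f_def)
      have "1 / real (Suc m) \<le> 1 / real (Suc N)" "1 / real (Suc n) \<le> 1 / real (Suc N)"
        using that by (simp_all add: frac_le)
      then have "gram K (\<lambda>x. U m x - U n x) (\<lambda>x. U m x - U n x) < e\<^sup>2"
        using close[of m n] N by simp
      then have "sqrt (gram K (\<lambda>x. U m x - U n x) (\<lambda>x. U m x - U n x)) < sqrt (e\<^sup>2)"
        by (rule real_sqrt_less_mono)
      then show ?thesis using \<open>e > 0\<close> unfolding eq by (simp add: ip_embedding_embedding)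
    qed
    then show ?thesis by blast
  qed
  then obtain g where g: "g \<in> H"
    and lim: "(\<lambda>n. sqrt (ip (\<lambda>x\<in>S. f n x - g x) (\<lambda>x\<in>S. f n x - g x))) \<longlonglongrightarrow> 0"
    using complete[of f] f by blast
  define r where "r n = (\<lambda>x\<in>S. f n x - g x)" for n
  have r: "r n \<in> H" for n unfolding r_def by (intro diff_mem f g)
  have inv_lim: "(\<lambda>n. 1 / real (Suc n)) \<longlonglongrightarrow> 0"
    using LIMSEQ_inverse_real_of_nat by (simp add: inverse_eq_divide)
  have g_eq: "g t = pairing w (K t)" if t: "t \<in> S" for t
  proof -
    let ?k = "\<lambda>x\<in>S. K t x"
    have "(\<lambda>n. sqrt (ip (r n) (r n)) * sqrt (ip ?k ?k)) \<longlonglongrightarrow> 0"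
      using tendsto_mult_right[OF lim, of "sqrt (ip ?k ?k)"] by (simp add: r_def)
    moreover have "norm (f n t - g t) \<le> sqrt (ip (r n) (r n)) * sqrt (ip ?k ?k)" for n
    proof -
      have "ip (r n) ?k = f n t - g t"
        unfolding reproducing[OF r t] using t by (simp add: r_def)
      then show ?thesis using ip_cauchy_schwarz[OF r[of n] kernel_mem[OF t]] by simp
    qed
    ultimately have "(\<lambda>n. f n t - g t) \<longlonglongrightarrow> 0"
      by (rule Lim_null_comparison[rotated, OF _ always_eventually[OF allI]])
    moreover have "(\<lambda>n. f n t - pairing w (K t)) \<longlonglongrightarrow> 0"
    proof -
      have bound: "\<bar>f n t - pairing w (K t)\<bar> \<le> sqrt (1 / real (Suc n) * K t t)" for n
      proof -
        let ?p = "point_mass t" and ?d = "\<lambda>x. w x - U n x"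
        have p [simp]: "?p \<in> finsupp S" using t by simp
        have gp: "gram K ?p v = pairing v (K t)" for v by (simp add: gram_def)
        have Ktt: "K t t \<ge> 0" using B.gram_nonneg[of ?p] by (simp add: gp)
        \<comment> \<open>moving from \<open>U n\<close> along \<open>?p\<close> cannot bring the deviation below \<open>D\<close>\<close>
        have "(gram K ?p ?d)\<^sup>2 \<le> (dev (U n) - D) * gram K ?p ?p"
        proof (rule nonneg_quadratic_imp_discriminant)
          fix c
          have "D \<le> dev (\<lambda>x. U n x - c * ?p x)" by (intro D_le finsupp_diff finsupp_scale U p)
          also have "\<dots> = dev (U n) + 2 * c * gram K ?p ?d + c\<^sup>2 * gram K ?p ?p"
          proof -
            have "(\<lambda>x. w x - (U n x - c * ?p x)) = (\<lambda>x. ?d x + c * ?p x)" by auto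
            then show ?thesis using B.gram_add_scale[of ?d ?p c] B.gram_sym[of ?p ?d]
              by (simp add: dev_def)
          qed
          finally show "0 \<le> dev (U n) - D + 2 * c * gram K ?p ?d + c\<^sup>2 * gram K ?p ?p" by simp
        qed (simp add: B.gram_nonneg)
        also have "\<dots> \<le> 1 / real (Suc n) * K t t"
          using dev_U[of n] Ktt by (intro mult_mono) (auto simp: gp)
        finally have "sqrt ((gram K ?p ?d)\<^sup>2) \<le> sqrt (1 / real (Suc n) * K t t)"
          by (rule real_sqrt_le_mono)
        moreover have "gram K ?p ?d = pairing w (K t) - f n t"
        proof -
          have "gram K ?p ?d = gram K ?p w - gram K ?p (U n)" by (simp add: B.gram_linear)
          then show ?thesis using t by (simp add: gp f_def)
        qed
        ultimately show ?thesis by (simp add: abs_minus_commute)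
      qed
      have "(\<lambda>n. sqrt (1 / real (Suc n) * K t t)) \<longlonglongrightarrow> sqrt (0 * K t t)"
        by (intro tendsto_intros inv_lim)
      then have "(\<lambda>n. sqrt (1 / real (Suc n) * K t t)) \<longlonglongrightarrow> 0" by simp
      then show ?thesis
        by (rule Lim_null_comparison[rotated]) (use bound in auto)
    qed
    ultimately have "(\<lambda>n. (f n t - pairing w (K t)) - (f n t - g t)) \<longlonglongrightarrow> 0 - 0"
      by (intro tendsto_diff)
    then show ?thesis by (simp add: LIMSEQ_const_iff)
  qed
  have "g \<in> extensional S" using g extensional by blast
  then have g_restrict: "(\<lambda>x\<in>S. pairing w (K x)) = g"
    using g_eq by (auto simp: extensional_def restrict_def)
  show "(\<lambda>x\<in>S. pairing w (K x)) \<in> H" using g g_restrict by simp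
  have le: "ip g g \<le> gram K w w + (sqrt (ip (r n) (r n)))\<^sup>2" for n
  proof -
    have "ip (f n) g = gram K (U n) w"
      unfolding f_def ip_embedding[OF U g] gram_def using g_eq by (intro pairing_cong[OF U])
    moreover have "ip (f n) (f n) = gram K (U n) (U n)"
      unfolding f_def by (simp add: ip_embedding_embedding)
    moreover have "ip (r n) (r n) = ip (f n) (f n) - 2 * ip (f n) g + ip g g"
    proof -
      have "ip (r n) (r n) = ip (f n) (r n) - ip g (r n)"
        using ip_diff_left[OF f g r] by (simp add: r_def)
      also have "ip (f n) (r n) = ip (f n) (f n) - ip g (f n)"
        using ip_diff_left[OF f g f] ip_commute[OF f r] by (simp add: r_def)
      also have "ip g (r n) = ip (f n) g - ip g g"
        using ip_diff_left[OF f g g] ip_commute[OF g r] by (simp add: r_def)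
      also have "ip g (f n) = ip (f n) g" by (rule ip_commute[OF g f])
      finally show ?thesis by simp
    qed
    moreover have "gram K w (U n) = gram K (U n) w" by (intro B.gram_sym) simp_all
    ultimately show ?thesis
      using dev_nonneg[OF U, of n] ip_nonneg[OF r, of n] by (simp add: dev_eq)
  qed
  have "(\<lambda>n. gram K w w + (sqrt (ip (r n) (r n)))\<^sup>2) \<longlonglongrightarrow> gram K w w + 0\<^sup>2"
    using lim unfolding r_def by (intro tendsto_intros)
  then have "ip g g \<le> gram K w w + 0\<^sup>2"
    by (rule LIMSEQ_le_const) (use le in blast)
  then show "ip (\<lambda>x\<in>S. pairing w (K x)) (\<lambda>x\<in>S. pairing w (K x)) \<le> gram K w w"
    unfolding g_restrict by simp
qed

lemma kernel_section_mem:
  assumes "covariance_on B K" "S \<subseteq> B" "s \<in> B"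
  shows "(\<lambda>x\<in>S. K s x) \<in> H"
proof -
  have "(\<lambda>x\<in>S. pairing (point_mass s) (K x)) = (\<lambda>x\<in>S. K s x)"
    using assms by (auto simp: covariance_on_def subset_iff intro!: restrict_ext)
  then show ?thesis
    using restriction_contraction(1)[OF assms(1,2), of "point_mass s"] assms(3) by simp
qed

text \<open>
  The Schur complement is taken on all of \<open>B\<close>, where it vanishes as soon as one argument lies in \<open>S\<close>.
\<close>

theorem covariance_on_schur_complement:
  assumes cov: "covariance_on B K" and sub: "S \<subseteq> B"
  shows "covariance_on B (\<lambda>s t. K s t - ip (\<lambda>x\<in>S. K s x) (\<lambda>x\<in>S. K t x))"
  unfolding covariance_on_iff_gram
proof (intro conjI ballI)
  let ?P = "\<lambda>s t. ip (\<lambda>x\<in>S. K s x) (\<lambda>x\<in>S. K t x)"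
  note k = kernel_section_mem[OF cov sub]
  show "K s t - ?P s t = K t s - ?P t s" if "s \<in> B" "t \<in> B" for s t
    using that cov ip_commute[OF k k, of s t] by (simp add: covariance_on_def)
  fix u assume u: "u \<in> finsupp B"
  have eq: "(\<lambda>x\<in>S. pairing u (\<lambda>s. (\<lambda>x\<in>S. K s x) x)) = (\<lambda>x\<in>S. pairing u (K x))"
    using cov sub by (intro restrict_ext pairing_cong[OF u]) (auto simp: covariance_on_def)
  have "gram ?P u u = ip (\<lambda>x\<in>S. pairing u (\<lambda>s. (\<lambda>x\<in>S. K s x) x))
      (\<lambda>x\<in>S. pairing u (\<lambda>s. (\<lambda>x\<in>S. K s x) x))"
    by (rule gram_feature_map[OF u k])
  also have "\<dots> \<le> gram K u u"
    unfolding eq by (rule restriction_contraction(2)[OF cov sub u])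
  finally have "gram ?P u u \<le> gram K u u" .
  moreover have "gram (\<lambda>s t. K s t - ?P s t) u u = gram K u u - gram ?P u u"
    by (simp add: gram_eq_sum sum_subtractf algebra_simps)
  ultimately show "gram (\<lambda>s t. K s t - ?P s t) u u \<ge> 0" by simp
qed

end

section \<open>Characterisation of the completions\<close>

theorem theorem6p1:
  fixes I I\<^sub>1 I\<^sub>2 :: "real set"
    and \<Omega> :: "(real \<times> real) set"
    and K\<^sub>\<Omega> K :: "real \<Rightarrow> real \<Rightarrow> real"
  assumes "is_interval I" and "is_interval I\<^sub>1" and "is_interval I\<^sub>2"
    and "I = I\<^sub>1 \<union> I\<^sub>2"
    and "\<Omega> = two_block_domain I\<^sub>1 I\<^sub>2"
    and "partial_covariance_on I \<Omega> K\<^sub>\<Omega>"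
  shows "is_completion I \<Omega> K\<^sub>\<Omega> K \<longleftrightarrow>
    (\<exists>C :: real \<Rightarrow> real \<Rightarrow> real.
       (\<forall>s\<in>I. \<forall>t\<in>I. K s t = canonical_completion I\<^sub>1 I\<^sub>2 K\<^sub>\<Omega> s t + C s t) \<and>
       (\<forall>(s, t)\<in>(I\<^sub>1 \<times> I\<^sub>1) \<union> (I\<^sub>2 \<times> I\<^sub>2). C s t = 0) \<and>
       covariance_on ((I\<^sub>1 - I\<^sub>2) \<union> (I\<^sub>2 - I\<^sub>1))
         (\<lambda>s t. if s \<in> I\<^sub>1 - I\<^sub>2 \<and> t \<in> I\<^sub>1 - I\<^sub>2 then schur_complement K\<^sub>\<Omega> (I\<^sub>1 \<inter> I\<^sub>2) s t
                else if s \<in> I\<^sub>2 - I\<^sub>1 \<and> t \<in> I\<^sub>2 - I\<^sub>1 then schur_complement K\<^sub>\<Omega> (I\<^sub>1 \<inter> I\<^sub>2) s t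
                else C s t))"
    (is "_ \<longleftrightarrow> (\<exists>C. ?sum C \<and> ?zero C \<and> covariance_on ?D (?L C))")
proof -
  define A where "A = I\<^sub>1 \<inter> I\<^sub>2"
  define H where "H = fst (rkhs A K\<^sub>\<Omega>)"
  define ip where "ip = snd (rkhs A K\<^sub>\<Omega>)"
  define P where "P = (\<lambda>s t. ip (\<lambda>x\<in>A. K\<^sub>\<Omega> s x) (\<lambda>x\<in>A. K\<^sub>\<Omega> t x))"
  have I: "I = I\<^sub>1 \<union> I\<^sub>2" and \<Omega>: "\<Omega> = (I\<^sub>1 \<times> I\<^sub>1) \<union> (I\<^sub>2 \<times> I\<^sub>2)"
    using assms by (auto simp: two_block_domain_def)
  have cov1: "covariance_on I\<^sub>1 K\<^sub>\<Omega>" and cov2: "covariance_on I\<^sub>2 K\<^sub>\<Omega>"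
    using assms(6) unfolding partial_covariance_on_def I \<Omega> by blast+
  have A1: "A \<subseteq> I\<^sub>1" and A2: "A \<subseteq> I\<^sub>2" and AI: "A \<subseteq> I" by (auto simp: A_def I)
  have rk: "reproducing_kernel_hilbert_space A K\<^sub>\<Omega> H ip"
    unfolding H_def ip_def
    by (intro reproducing_kernel_hilbert_space_rkhs covariance_on_mono[OF cov1 A1])
  then interpret reproducing_kernel_hilbert_space A K\<^sub>\<Omega> H ip .
  have k: "(\<lambda>x\<in>A. K\<^sub>\<Omega> s x) \<in> H" if "s \<in> I" for s
    using that kernel_section_mem[OF cov1 A1] kernel_section_mem[OF cov2 A2] by (auto simp: I)
  have sym: "K\<^sub>\<Omega> s t = K\<^sub>\<Omega> t s" if "(s, t) \<in> \<Omega>" for s t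
    using that cov1 cov2 by (auto simp: \<Omega> covariance_on_def)
  have A_\<Omega>: "(s, t) \<in> \<Omega>" "(t, s) \<in> \<Omega>" if "s \<in> A" "t \<in> I" for s t
    using that by (auto simp: A_def I \<Omega>)
  have inner: "rkhs_inner (I\<^sub>1 \<inter> I\<^sub>2) K\<^sub>\<Omega> (\<lambda>x. K\<^sub>\<Omega> s x) (\<lambda>x. K\<^sub>\<Omega> x t) = P s t" if "t \<in> I" for s t
  proof -
    have "(\<lambda>x\<in>A. K\<^sub>\<Omega> x t) = (\<lambda>x\<in>A. K\<^sub>\<Omega> t x)"
      using sym A_\<Omega> that by (intro restrict_ext) blast
    then show ?thesis by (simp add: rkhs_inner_def P_def ip_def A_def)
  qed
  have canonical: "canonical_completion I\<^sub>1 I\<^sub>2 K\<^sub>\<Omega> s t = (if (s, t) \<in> \<Omega> then K\<^sub>\<Omega> s t else P s t)"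
    if "t \<in> I" for s t
    using inner[OF that] by (simp add: canonical_completion_def assms(5))
  have schur: "schur_complement K\<^sub>\<Omega> (I\<^sub>1 \<inter> I\<^sub>2) s t = K\<^sub>\<Omega> s t - P s t" if "t \<in> I" for s t
    using inner[OF that] by (simp add: schur_complement_def)
  have P_right: "P t s = K\<^sub>\<Omega> t s" if "s \<in> A" "t \<in> I" for s t
    using that reproducing[OF k[of t]] by (simp add: P_def)
  have P_left: "P s t = K\<^sub>\<Omega> s t" if s: "s \<in> A" and t: "t \<in> I" for s t
  proof -
    have "P s t = P t s" unfolding P_def using s t AI by (intro ip_commute k) auto
    then show ?thesis using P_right[OF s t] sym[OF A_\<Omega>(1)[OF s t]] by simp
  qed
  have D: "?D = I - A" by (auto simp: I A_def)
  show ?thesis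
  proof
    assume "is_completion I \<Omega> K\<^sub>\<Omega> K"
    then have cov: "covariance_on I K" and agree: "\<And>s t. (s, t) \<in> \<Omega> \<Longrightarrow> K s t = K\<^sub>\<Omega> s t"
      by (auto simp: is_completion_def)
    define C where "C = (\<lambda>s t. K s t - canonical_completion I\<^sub>1 I\<^sub>2 K\<^sub>\<Omega> s t)"
    interpret K: reproducing_kernel_hilbert_space A K H ip
    proof (rule reproducing_kernel_hilbert_space_cong[OF rk])
      show "K\<^sub>\<Omega> s t = K s t" if "s \<in> A" "t \<in> A" for s t
        using that agree A_\<Omega> AI by (metis subsetD)
    qed
    have sections: "(\<lambda>x\<in>A. K s x) = (\<lambda>x\<in>A. K\<^sub>\<Omega> s x)" if "s \<in> I" for s
      using agree A_\<Omega> that by (intro restrict_ext) blast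
    have "covariance_on I (\<lambda>s t. K s t - P s t)"
      using K.covariance_on_schur_complement[OF cov AI]
      by (subst covariance_on_cong[of I _ "\<lambda>s t. K s t - ip (\<lambda>x\<in>A. K s x) (\<lambda>x\<in>A. K t x)"])
        (auto simp: P_def sections)
    then have "covariance_on ?D (\<lambda>s t. K s t - P s t)"
      by (rule covariance_on_mono) (auto simp: D)
    moreover have "?L C s t = K s t - P s t" if "s \<in> ?D" "t \<in> ?D" for s t
      using that agree[of s t] by (auto simp: schur canonical C_def I \<Omega>)
    ultimately have "covariance_on ?D (?L C)"
      by (subst covariance_on_cong[of ?D _ "\<lambda>s t. K s t - P s t"]) auto
    moreover have "?zero C" using agree by (auto simp: C_def canonical I \<Omega>)
    moreover have "?sum C" by (simp add: C_def)
    ultimately show "\<exists>C. ?sum C \<and> ?zero C \<and> covariance_on ?D (?L C)" by blast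
  next
    assume "\<exists>C. ?sum C \<and> ?zero C \<and> covariance_on ?D (?L C)"
    then obtain C where sum: "?sum C" and zero: "?zero C" and cov: "covariance_on ?D (?L C)"
      by blast
    have agree: "K s t = K\<^sub>\<Omega> s t" if st: "(s, t) \<in> \<Omega>" for s t
    proof -
      have "s \<in> I" "t \<in> I" "C s t = 0" using st zero unfolding I \<Omega> by blast+
      then show ?thesis using sum st by (simp add: canonical)
    qed
    have "covariance_on I (\<lambda>s t. P s t + (if s \<in> ?D \<and> t \<in> ?D then ?L C s t else 0))"
      unfolding P_def
      by (intro covariance_on_add covariance_on_feature_map covariance_on_extend_zero cov k)
    moreover have "P s t + (if s \<in> ?D \<and> t \<in> ?D then ?L C s t else 0) = K s t"
      if s: "s \<in> I" and t: "t \<in> I" for s t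
    proof (cases "s \<in> A \<or> t \<in> A")
      case True
      then have out: "\<not> (s \<in> ?D \<and> t \<in> ?D)" unfolding D by blast
      have "(s, t) \<in> \<Omega>" using True s t A_\<Omega> by blast
      moreover have "P s t = K\<^sub>\<Omega> s t" using True s t P_left P_right by blast
      ultimately show ?thesis unfolding if_not_P[OF out] by (simp add: agree)
    next
      case False
      then have inside: "s \<in> ?D \<and> t \<in> ?D" using s t unfolding D by blast
      have "?L C s t = K s t - P s t"
      proof (cases "(s, t) \<in> \<Omega>")
        case True
        then show ?thesis
          using False schur[OF t, of s] agree[OF True] by (auto simp: A_def \<Omega>)
      next
        case notin: False
        then have "?L C s t = C s t" by (auto simp: \<Omega>)
        also have "\<dots> = K s t - P s t" using sum s t notin by (simp add: canonical)
        finally show ?thesis .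
      qed
      then show ?thesis unfolding if_P[OF inside] by linarith
    qed
    ultimately have "covariance_on I K"
      by (subst (asm) covariance_on_cong[of I _ K]) auto
    then show "is_completion I \<Omega> K\<^sub>\<Omega> K" using agree by (auto simp: is_completion_def)
  qed
qed

end
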